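(* Let $1\le k\leq m$ be integers. The Hilbert measure $\lambda_{k,m}(\boldsymbol{u})\,d\boldsymbol{u}$ on $\boldsymbol{u}(V_k)\simeq V_k/\operatorname{O}_m$ is $$\lambda_{k,m}(\boldsymbol{u})\, d\boldsymbol{u} = \frac{|G_k|^{(m-k-1)/2}}{2^{k}}\prod_{j=1}^{k}\operatorname{Vol}(S^{m-j})\; d\boldsymbol{u} = \frac{1}{2^{k}}\operatorname{Vol}(\operatorname{O}_{m}/\operatorname{O}_{m-k})\,|G_k|^{(m-k-1)/2}\, d\boldsymbol{u},$$ where $\operatorname{Vol}(\operatorname{O}_m/\operatorname{O}_{m-k})$ is the volume of the Stiefel manifold $\operatorname{O}_m/\operatorname{O}_{m-k}$ and $|G_k|$ is the determinant of the Gram matrix $G_k=(u_{i,j})_{i,j\in\{1,\ldots,k\}}$.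
   Context: $\operatorname{O}_m=\operatorname{O}_m(\mathbb{R})$ is the real orthogonal group, and $V_k=\mathbb{R}^{mk}=(\mathbb{R}^m)^k$ carries the diagonal action $A(\boldsymbol{v}_1,\ldots,\boldsymbol{v}_k)=(A\boldsymbol{v}_1,\ldots,A\boldsymbol{v}_k)$, with $\boldsymbol{v}_i\in\mathbb{R}^m$. The Hilbert embedding is the map $$\boldsymbol{u}=(u_{i,j})_{1\le j\le i\le k}\colon V_k\to\mathbb{R}^{\binom{k+1}{2}},\qquad u_{i,j}=u_{j,i}=\langle\boldsymbol{v}_i,\boldsymbol{v}_j\rangle$$ (standard inner product); it induces an identification of the orbit space $V_k/\operatorname{O}_m$ with the image $\boldsymbol{u}(V_k)$. The symbols $u_{i,j}$ with $u_{i,j}=u_{j,i}$ also denote the coordinates on $\mathbb{R}^{\binom{k+1}{2}}$, $G_k=(u_{i,j})_{i,j\in\{1,\ldots,k\}}$ is the corresponding symmetric $k\times k$ matrix, and $d\boldsymbol{u}=\prod_{1\le j\le i\le k}du_{i,j}$ is Lebesgue measure on $\mathbb{R}^{\binom{k+1}{2}}$. The Hilbert measure $\lambda_{k,m}(\boldsymbol{u})\,d\boldsymbol{u}$ on $\boldsymbol{u}(V_k)$ is the measure uniquely determined by the condition that $$\int_{V_k} f(\boldsymbol{v}_1,\ldots,\boldsymbol{v}_k)\,d\boldsymbol{v}_1\cdots d\boldsymbol{v}_k=\int_{\boldsymbol{u}(V_k)}F(\boldsymbol{u})\,\lambda_{k,m}(\boldsymbol{u})\,d\boldsymbol{u}$$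 for each compactly supported smooth $\operatorname{O}_m$-invariant function $f\in\mathcal{C}_c^\infty(V_k)^{\operatorname{O}_m}$, where $d\boldsymbol{v}_i$ is Lebesgue measure on the $i$th copy of $\mathbb{R}^m$ and $F\in\mathcal{C}_c^\infty(\mathbb{R}^{\binom{k+1}{2}})$ is such that $f(\boldsymbol{v}_1,\ldots,\boldsymbol{v}_k)=F(\boldsymbol{u}(\boldsymbol{v}_1,\ldots,\boldsymbol{v}_k))$. Volumes: $\operatorname{Vol}(S^{n-1})=\frac{2\pi^{n/2}}{\Gamma(n/2)}$ is the volume of the unit sphere in $\mathbb{R}^n$ for $n\ge1$ (so $\operatorname{Vol}(S^0)=2$). The volume of the orthogonal group is normalized as $\operatorname{Vol}(\operatorname{O}_n)=\frac{2^n\sqrt{\pi}^{\binom{n+1}{2}}}{\prod_{j=1}^n\Gamma(j/2)}$, with $\operatorname{Vol}(\operatorname{O}_0)=1$, and $\operatorname{Vol}(\operatorname{O}_m/\operatorname{O}_{m-k})=\operatorname{Vol}(\operatorname{O}_m)/\operatorname{Vol}(\operatorname{O}_{m-k})$. *)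

theory Defs
  imports "HOL-Analysis.Analysis" "HOL-Library.Uprod"
begin

text \<open>
  \<^typ>\<open>'k uprod\<close>, the type of unordered pairs of indices, has \<open>CARD('k) * (CARD('k) + 1) / 2\<close>
  elements, and indexes the coordinates \<open>u\<^sub>i\<^sub>,\<^sub>j = u\<^sub>j\<^sub>,\<^sub>i\<close>. So the Euclidean space
  \<^typ>\<open>real ^ ('k uprod)\<close> has exactly one coordinate for each pair \<open>j \<le> i\<close>, and \<^const>\<open>lborel\<close>
  on it is the Lebesgue measure \<open>\<Prod>\<^bsub>j \<le> i\<^esub> du\<^sub>i\<^sub>,\<^sub>j\<close>.
\<close>

instance uprod :: (finite) finite
  by standard simp

text \<open>A point of \<open>V\<^sub>k\<close> is \<open>v :: real ^ 'm ^ 'k\<close>; its components are the vectors \<open>v $ i :: real ^ 'm\<close>.\<close>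

lift_definition gram_entry :: "real ^ 'm::finite ^ 'k::finite \<Rightarrow> 'k uprod \<Rightarrow> real"
  is "\<lambda>v (i, j). v $ i \<bullet> v $ j"
  by (auto simp: inner_commute)

lemma gram_entry_Upair [simp]: "gram_entry v (Upair i j) = v $ i \<bullet> v $ j"
  by transfer simp

definition hilbert_embedding :: "real ^ 'm::finite ^ 'k::finite \<Rightarrow> real ^ ('k uprod)" where
  "hilbert_embedding v = (\<chi> p. gram_entry v p)"

definition gram_matrix :: "real ^ ('k::finite uprod) \<Rightarrow> real ^ 'k ^ 'k" where
  "gram_matrix u = (\<chi> i j. u $ Upair i j)"

definition diag_action :: "real ^ 'm ^ 'm \<Rightarrow> real ^ 'm::finite ^ 'k::finite \<Rightarrow> real ^ 'm ^ 'k" where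
  "diag_action A v = (\<chi> i. A *v (v $ i))"

definition orthogonal_invariant :: "(real ^ 'm::finite ^ 'k::finite \<Rightarrow> real) \<Rightarrow> bool" where
  "orthogonal_invariant f \<longleftrightarrow> (\<forall>A v. orthogonal_matrix A \<longrightarrow> f (diag_action A v) = f v)"

text \<open>
  On a finite-dimensional space \<open>times_cont_diff n f\<close> says that \<open>f\<close> is \<open>C\<^sup>n\<close>: all directional
  derivatives of the derivative of \<open>f\<close> are \<open>C\<^sup>n\<^sup>-\<^sup>1\<close>.
\<close>

primrec times_cont_diff :: "nat \<Rightarrow> ('a::euclidean_space \<Rightarrow> real) \<Rightarrow> bool" where
  "times_cont_diff 0 f \<longleftrightarrow> continuous_on UNIV f"
| "times_cont_diff (Suc n) f \<longleftrightarrow>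
     (\<forall>x. f differentiable (at x)) \<and>
     (\<forall>v. times_cont_diff n (\<lambda>x. frechet_derivative f (at x) v))"

definition smooth_compact_support :: "('a::euclidean_space \<Rightarrow> real) \<Rightarrow> bool" where
  "smooth_compact_support f \<longleftrightarrow>
     (\<forall>n. times_cont_diff n f) \<and> compact (closure {x. f x \<noteq> 0})"

text \<open>
  A Hilbert measure lives on the subspace \<open>u(V\<^sub>k)\<close>, not on all of \<^typ>\<open>real ^ ('k uprod)\<close>.
  Integrability of \<open>F\<close> is required explicitly because the Bochner integral of a non-integrable
  function is \<open>0\<close>; \<open>f\<close> is integrable, being continuous with compact support. No separate
  regularity of \<open>M\<close> is imposed: the integrability already makes \<open>M\<close> finite on bounded sets.
\<close>

definition is_hilbert_measure ::
    "'m::finite itself \<Rightarrow> (real ^ ('k::finite uprod)) measure \<Rightarrow> bool" where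
  "is_hilbert_measure TYPE('m) M \<longleftrightarrow>
     sets M = sets (restrict_space borel (range (hilbert_embedding :: real ^ 'm ^ 'k \<Rightarrow> _))) \<and>
     (\<forall>(f :: real ^ 'm ^ 'k \<Rightarrow> real) F.
        smooth_compact_support f \<and> orthogonal_invariant f \<and>
        smooth_compact_support F \<and> (\<forall>v. f v = F (hilbert_embedding v)) \<longrightarrow>
        integrable M F \<and> (\<integral>v. f v \<partial>lborel) = (\<integral>u. F u \<partial>M))"

text \<open>\<open>vol_sphere d\<close> is the volume of \<open>S\<^sup>d\<close>, the unit sphere in dimension \<open>d + 1\<close>.\<close>

definition vol_sphere :: "nat \<Rightarrow> real" where
  "vol_sphere d = 2 * pi powr ((real d + 1) / 2) / Gamma ((real d + 1) / 2)"

definition vol_orthogonal :: "nat \<Rightarrow> real" where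
  "vol_orthogonal n = 2 ^ n * sqrt pi ^ ((n + 1) choose 2) / (\<Prod>j = 1..n. Gamma (real j / 2))"

text \<open>The volume of the Stiefel manifold \<open>O\<^sub>m / O\<^sub>m\<^sub>-\<^sub>k\<close>, meaningful for \<open>k \<le> m\<close>.\<close>

definition vol_stiefel :: "nat \<Rightarrow> nat \<Rightarrow> real" where
  "vol_stiefel m k = vol_orthogonal m / vol_orthogonal (m - k)"

end

theory Submission
  imports Defs
begin

text \<open>
  Both densities describe the push-forward of Lebesgue measure under the Hilbert embedding.
  A Hilbert measure is determined by its integrals over products of the bump functions \<open>exp (-1/x)\<close> in the
  coordinates, which increase to indicators of boxes and pull back to admissible functions \<open>f\<close>; so there is
  exactly one.

  The push-forward is computed by adding the vectors one at a time. For fixed independent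
  \<open>v\<^sub>1, \<dots>, v\<^sub>n\<close> in \<open>\<real>\<^sup>m\<close> with Gram determinant \<open>D\<close>, complete them by an orthonormal basis of the orthogonal complement
  to a matrix \<open>A\<close>; then \<open>\<bar>det A\<bar> = sqrt D\<close>, and \<open>x \<mapsto> A x\<close> together with polar coordinates in the complement
  shows that \<open>((x \<bullet> v\<^sub>i)\<^sub>i, x \<bullet> x)\<close> has density \<open>Vol(S\<^sup>m\<^sup>-\<^sup>n\<^sup>-\<^sup>1)/2 * D powr (-1/2) * s powr ((m - n)/2 - 1)\<close>, where
  \<open>s = D'/D\<close> is the Schur complement and \<open>D'\<close> the determinant of the enlarged Gram matrix. Multiplied with
  the density \<open>D powr ((m - n - 1)/2)\<close> this gives \<open>D' powr ((m - n - 2)/2)\<close>.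
\<close>

section \<open>Smooth functions and bumps\<close>

text \<open>The index set of the Gram matrix grows during the induction while the type
  \<open>'k\<close> stays fixed. So determinants are Leibniz sums over finite subsets
  (\<open>sub_det\<close>), partial Gram data are functions on \<open>pairs I\<close>, and the
  matrices realised by independent vectors form \<open>gram_region\<close>. Adding one index
  multiplies a Gram determinant by the squared height of the new vector
  (\<open>gram_det_insert\<close>); this identity yields independence, the Schur complement and the
  recursion for the region. All computations are with nonnegative integrals, so Tonelli applies
  without integrability, also for k = m, where the exponent -1/2 makes the density unbounded near
  det = 0. Each step needs D > 0; dependent tuples are discarded by the induction hypothesis itself,
  applied to the indicator of D \<le> 0. The power 2^k collects one half per vector, which arises
  from measuring heights by their squares. Uniqueness needs finite mass on boxes: the diagonal
  coordinates are squared norms, so preimages of boxes are bounded.\<close>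

lemma times_cont_diff_Suc_imp: "times_cont_diff (Suc n) f \<Longrightarrow> times_cont_diff n f"
proof (induction n arbitrary: f)
  case 0
  then show ?case
    by (auto simp: continuous_on_eq_continuous_at intro!: differentiable_imp_continuous_within)
qed auto

lemma times_cont_diff_const: "times_cont_diff n (\<lambda>x. c)"
  by (induction n arbitrary: c) auto

lemma times_cont_diff_inner_left: "times_cont_diff n (\<lambda>x. x \<bullet> b)"
proof (cases n)
  case (Suc k)
  have "((\<lambda>x. x \<bullet> b) has_derivative (\<lambda>x. x \<bullet> b)) (at x)" for x :: 'a
    by (auto intro!: derivative_eq_intros)
  then have "frechet_derivative (\<lambda>x. x \<bullet> b) (at x) = (\<lambda>x. x \<bullet> b)" for x :: 'a
    by (metis frechet_derivative_at)
  then show ?thesis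
    by (auto simp: Suc times_cont_diff_const)
qed (auto intro!: continuous_intros)

lemma times_cont_diff_add:
  assumes "times_cont_diff n f" "times_cont_diff n g"
  shows "times_cont_diff n (\<lambda>x. f x + g x)"
  using assms
proof (induction n arbitrary: f g)
  case 0
  then show ?case by (auto intro: continuous_on_add)
next
  case (Suc n)
  then have "frechet_derivative (\<lambda>x. f x + g x) (at x) v
      = frechet_derivative f (at x) v + frechet_derivative g (at x) v" for x v
    by (subst frechet_derivative_at[symmetric, OF has_derivative_add])
       (auto simp: frechet_derivative_works[symmetric])
  with Suc show ?case by (auto intro: differentiable_add)
qed

lemma times_cont_diff_mult:
  assumes "times_cont_diff n f" "times_cont_diff n g"
  shows "times_cont_diff n (\<lambda>x. f x * g x)"
  using assms
proof (induction n arbitrary: f g)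
  case 0
  then show ?case by (auto intro: continuous_on_mult)
next
  case (Suc n)
  then have "frechet_derivative (\<lambda>x. f x * g x) (at x) v
      = f x * frechet_derivative g (at x) v + frechet_derivative f (at x) v * g x" for x v
    by (subst frechet_derivative_at[symmetric, OF has_derivative_mult])
       (auto simp: frechet_derivative_works[symmetric])
  moreover have "times_cont_diff n f" "times_cont_diff n g"
    using Suc.prems times_cont_diff_Suc_imp by blast+
  ultimately show ?case
    using Suc by (auto intro!: times_cont_diff_add)
qed

lemma times_cont_diff_sum:
  "finite A \<Longrightarrow> (\<And>a. a \<in> A \<Longrightarrow> times_cont_diff n (f a)) \<Longrightarrow> times_cont_diff n (\<lambda>x. \<Sum>a\<in>A. f a x)"
  by (induction A rule: finite_induct) (auto intro: times_cont_diff_const times_cont_diff_add)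

lemma times_cont_diff_prod:
  "finite A \<Longrightarrow> (\<And>a. a \<in> A \<Longrightarrow> times_cont_diff n (f a)) \<Longrightarrow> times_cont_diff n (\<lambda>x. \<Prod>a\<in>A. f a x)"
  by (induction A rule: finite_induct) (auto intro: times_cont_diff_const times_cont_diff_mult)

text \<open>For an outer function of one real variable the derivative is multiplication by its value
  at 1. So the chain rule gives a pointwise product, to which the product rule and the induction
  hypothesis for the derivative of h apply.\<close>

lemma times_cont_diff_compose:
  fixes h :: "real \<Rightarrow> real"
  assumes "times_cont_diff n h" "times_cont_diff n g"
  shows "times_cont_diff n (\<lambda>x. h (g x))"
  using assms
proof (induction n arbitrary: h g)
  case 0
  then show ?case
    using continuous_on_compose2[of UNIV h UNIV g] by auto
next
  case (Suc n)
  have h: "(h has_derivative frechet_derivative h (at y)) (at y)" for y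
    using Suc.prems by (auto simp: frechet_derivative_works[symmetric])
  have g: "(g has_derivative frechet_derivative g (at y)) (at y)" for y
    using Suc.prems by (auto simp: frechet_derivative_works[symmetric])
  have hg: "((\<lambda>x. h (g x)) has_derivative
      (\<lambda>v. frechet_derivative h (at (g x)) (frechet_derivative g (at x) v))) (at x)" for x
    by (rule has_derivative_compose[OF g h])
  have lin: "frechet_derivative h (at y) r = frechet_derivative h (at y) 1 * r" for y r
    using linear_scale[OF has_derivative_linear[OF h[of y]], of r 1] by simp
  have "frechet_derivative (\<lambda>x. h (g x)) (at x) v
      = frechet_derivative h (at (g x)) 1 * frechet_derivative g (at x) v" for x v
    unfolding frechet_derivative_at[OF hg, symmetric] by (rule lin)
  moreover have "times_cont_diff n g"
    using Suc.prems times_cont_diff_Suc_imp by blast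
  moreover have "times_cont_diff n (\<lambda>x. frechet_derivative h (at (g x)) 1)"
    using Suc.IH[of "\<lambda>y. frechet_derivative h (at y) 1" g] Suc.prems calculation(2) by auto
  moreover have "(\<lambda>x. h (g x)) differentiable at x" for x
    using hg differentiable_def by blast
  ultimately show ?case
    using Suc.prems by (auto intro!: times_cont_diff_mult)
qed

text \<open>Products of a polynomial in \<open>1/x\<close> and \<open>exp (-1/x)\<close> are closed under differentiation, so
  all of them are smooth.\<close>

definition poly_exp_recip :: "real poly \<Rightarrow> real \<Rightarrow> real" where
  "poly_exp_recip p x = (if x > 0 then poly p (1 / x) * exp (- (1 / x)) else 0)"

lemma poly_div_exp_tendsto_0: "((\<lambda>y. poly p y * exp (- y)) \<longlongrightarrow> (0::real)) at_top"
proof -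
  have "((\<lambda>y. \<Sum>i\<le>degree p. coeff p i * (y ^ i / exp y)) \<longlongrightarrow> (\<Sum>i\<le>degree p. coeff p i * 0)) at_top"
    by (intro tendsto_intros tendsto_power_div_exp_0)
  then show ?thesis
    by (simp add: poly_altdef sum_distrib_right exp_minus divide_inverse mult.assoc)
qed

text \<open>With y = 1/x, d/dx is -y^2 d/dy, and d/dy of p(y) exp(-y) is (p' - p)(y) exp(-y); hence
  the polynomial y^2 (p - p').\<close>

lemma poly_exp_recip_has_derivative:
  "(poly_exp_recip p has_real_derivative poly_exp_recip (monom 1 2 * (p - pderiv p)) x) (at x)"
proof -
  consider "x > 0" | "x = 0" | "x < 0" by linarith
  then show ?thesis
  proof cases
    case 1
    have "((\<lambda>x. poly p (1 / x) * exp (- (1 / x))) has_real_derivative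
        poly_exp_recip (monom 1 2 * (p - pderiv p)) x) (at x)"
      using 1 by (auto intro!: derivative_eq_intros DERIV_chain2[where f="poly p"] poly_DERIV
          simp: poly_exp_recip_def poly_monom field_simps power2_eq_square)
    then show ?thesis
      by (rule has_field_derivative_transform_within_open[where S="{0<..}"])
         (use 1 in \<open>auto simp: poly_exp_recip_def\<close>)
  next
    case 2
    have "((\<lambda>h. poly_exp_recip p h / h) \<longlongrightarrow> 0) (at_right 0)"
    proof -
      \<comment> \<open>The difference quotient at 0 in the variable y = 1/h: dividing by h
        multiplies p by y, which gives \<open>pCons 0 p\<close>.\<close>
      have "((\<lambda>y. poly (pCons 0 p) y * exp (- y)) \<longlongrightarrow> 0) (filtermap inverse (at_right (0::real)))"
        using poly_div_exp_tendsto_0[of "pCons 0 p"] at_top_to_right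
        by (simp add: at_right_to_top filtermap_filtermap)
      then have "((\<lambda>h. poly (pCons 0 p) (inverse h) * exp (- inverse h)) \<longlongrightarrow> 0) (at_right (0::real))"
        by (simp add: filterlim_filtermap)
      then show ?thesis
        by (rule Lim_transform_eventually)
           (auto simp: eventually_at_filter poly_exp_recip_def divide_inverse)
    qed
    moreover have "((\<lambda>h. poly_exp_recip p h / h) \<longlongrightarrow> 0) (at_left 0)"
      by (rule Lim_transform_eventually[OF tendsto_const])
         (auto simp: eventually_at_filter poly_exp_recip_def)
    ultimately have "((\<lambda>h. poly_exp_recip p h / h) \<longlongrightarrow> 0) (at 0)"
      by (rule filterlim_split_at[rotated])
    then show ?thesis
      using 2 by (simp add: DERIV_def poly_exp_recip_def)
  next
    case 3
    have "((\<lambda>x. 0) has_real_derivative poly_exp_recip (monom 1 2 * (p - pderiv p)) x) (at x)"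
      using 3 by (auto simp: poly_exp_recip_def)
    then show ?thesis
      by (rule has_field_derivative_transform_within_open[where S="{..<0}"])
         (use 3 in \<open>auto simp: poly_exp_recip_def\<close>)
  qed
qed

lemma times_cont_diff_poly_exp_recip: "times_cont_diff n (poly_exp_recip p)"
proof (induction n arbitrary: p)
  case 0
  show ?case
    using DERIV_continuous[OF poly_exp_recip_has_derivative]
    by (auto simp: continuous_on_eq_continuous_at)
next
  case (Suc n)
  have d: "(poly_exp_recip p has_derivative
      (*) (poly_exp_recip (monom 1 2 * (p - pderiv p)) x)) (at x)" for x
    using poly_exp_recip_has_derivative[of p x] by (simp add: has_field_derivative_def)
  then show ?case
    unfolding times_cont_diff.simps frechet_derivative_at[OF d, symmetric]
    by (auto simp: differentiable_def intro!: times_cont_diff_mult times_cont_diff_const Suc)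
qed

section \<open>The cutoff function exp(-1/x) and its scalings\<close>

definition exp_recip :: "real \<Rightarrow> real" where
  "exp_recip x = (if x > 0 then exp (- (1 / x)) else 0)"

lemma times_cont_diff_exp_recip: "times_cont_diff n exp_recip"
proof -
  have "exp_recip = poly_exp_recip 1"
    by (auto simp: exp_recip_def poly_exp_recip_def)
  then show ?thesis
    using times_cont_diff_poly_exp_recip by metis
qed

lemma exp_recip_nonneg: "0 \<le> exp_recip x"
  by (simp add: exp_recip_def)

lemma exp_recip_eq_0_iff: "exp_recip x = 0 \<longleftrightarrow> x \<le> 0"
  by (simp add: exp_recip_def)

lemma exp_recip_mono: "x \<le> y \<Longrightarrow> exp_recip x \<le> exp_recip y"
  by (auto simp: exp_recip_def frac_le)

text \<open>Scaling sends a positive x to infinity, where \<open>exp_recip\<close> tends to 1, and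
  keeps the half-line of zeros in place.\<close>

lemma exp_recip_scaled_tendsto:
  "(\<lambda>n. exp_recip (real n * x)) \<longlonglongrightarrow> indicator {0<..} x"
proof (cases "x > 0")
  case True
  have "(\<lambda>n. exp (- (1 / x * (1 / real n)))) \<longlonglongrightarrow> exp (- (1 / x * 0))"
    by (intro tendsto_intros lim_1_over_n)
  moreover have "eventually (\<lambda>n. exp (- (1 / x * (1 / real n))) = exp_recip (real n * x)) sequentially"
    using eventually_gt_at_top[of 0] by eventually_elim (use True in \<open>auto simp: exp_recip_def field_simps\<close>)
  ultimately show ?thesis
    using True by (auto intro: Lim_transform_eventually)
next
  case False
  then have "exp_recip (real n * x) = 0" for n
    by (auto simp: exp_recip_def mult_nonneg_nonpos not_less dest: zero_less_mult_pos)
  with False show ?thesis by simp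
qed

section \<open>Determinants over finite index sets\<close>

text \<open>The Leibniz formula over a subset of an index type: minors of different size live in one
  type, and an induction can add one index at a time.\<close>

definition sub_det :: "'i set \<Rightarrow> ('i \<Rightarrow> 'i \<Rightarrow> real) \<Rightarrow> real" where
  "sub_det I M = (\<Sum>p | p permutes I. of_int (sign p) * (\<Prod>i\<in>I. M i (p i)))"

lemma sub_det_empty [simp]: "sub_det {} M = 1"
  by (simp add: sub_det_def)

lemma sub_det_UNIV: "sub_det UNIV (\<lambda>i j. A $ i $ j) = det A"
  by (simp add: sub_det_def det_def)

lemma sub_det_cong:
  "(\<And>i j. i \<in> I \<Longrightarrow> j \<in> I \<Longrightarrow> M i j = N i j) \<Longrightarrow> sub_det I M = sub_det I N"
  unfolding sub_det_def by (intro sum.cong prod.cong arg_cong2[where f="(*)"])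
    (auto simp: permutes_in_image)

text \<open>Conjugation with h matches the permutations of I with those of J and preserves
  signs.\<close>

lemma sub_det_reindex:
  assumes "finite I" and h: "bij_betw h I J"
  shows "sub_det J M = sub_det I (\<lambda>i j. M (h i) (h j))"
proof -
  have inj: "inj_on h I" and im: "h ` I = J"
    using h by (auto simp: bij_betw_def)
  have "bij_betw (map_permutation I h) {p. p permutes I} {p. p permutes J}"
    using bij_betw_permutations[OF h]
    by (simp add: map_permutation_def[abs_def] restrict_id_def o_def im fun_eq_iff cong: if_cong)
  then have "sub_det J M = (\<Sum>p | p permutes I. of_int (sign (map_permutation I h p)) *
      (\<Prod>i\<in>J. M i (map_permutation I h p i)))"
    unfolding sub_det_def by (rule sum.reindex_bij_betw[symmetric])
  also have "\<dots> = sub_det I (\<lambda>i j. M (h i) (h j))"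
    unfolding sub_det_def
  proof (intro sum.cong refl arg_cong2[where f="(*)"])
    fix p assume p: "p \<in> {p. p permutes I}"
    show "of_int (sign (map_permutation I h p)) = (of_int (sign p) :: real)"
      using sign_map_permutation[OF inj, of p] p assms by simp
    show "(\<Prod>i\<in>J. M i (map_permutation I h p i)) = (\<Prod>i\<in>I. M (h i) (h (p i)))"
      unfolding im[symmetric] prod.reindex[OF inj] o_def
      by (intro prod.cong refl) (simp add: map_permutation_apply inj)
  qed
  finally show ?thesis .
qed

text \<open>Only permutations fixing a meet the diagonal entry at a, and these are the permutations
  of I. So the determinant is affine in that entry, with the minor on I as slope.\<close>

lemma sub_det_insert_split:
  assumes "finite I" "a \<notin> I"
  shows "sub_det (insert a I) M = M a a * sub_det I M
    + sub_det (insert a I) (\<lambda>i j. if i = a \<and> j = a then 0 else M i j)" (is "_ = _ + sub_det _ ?N")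
proof -
  let ?P = "{p. p permutes insert a I}" and ?Q = "{p. p permutes I}"
  have fin: "finite ?P"
    using assms by (simp add: finite_permutations)
  have sub: "?Q \<subseteq> ?P"
    by (auto intro: permutes_subset)
  have Q: "?Q = {p \<in> ?P. p a = a}"
    using assms by (auto intro: permutes_subset permutes_superset simp: permutes_not_in)
  have split: "sub_det (insert a I) L = (\<Sum>p\<in>?Q. of_int (sign p) * (\<Prod>i\<in>insert a I. L i (p i)))
      + (\<Sum>p\<in>?P - ?Q. of_int (sign p) * (\<Prod>i\<in>insert a I. L i (p i)))" for L
    unfolding sub_det_def by (subst sum.subset_diff[OF sub fin]) simp
  have 1: "(\<Sum>p\<in>?Q. of_int (sign p) * (\<Prod>i\<in>insert a I. M i (p i))) = M a a * sub_det I M"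
    unfolding sub_det_def sum_distrib_left using assms
    by (intro sum.cong) (auto simp: permutes_not_in)
  have 2: "(\<Sum>p\<in>?Q. of_int (sign p) * (\<Prod>i\<in>insert a I. ?N i (p i))) = 0"
    using assms by (intro sum.neutral) (auto simp: permutes_not_in)
  have 3: "(\<Sum>p\<in>?P - ?Q. of_int (sign p) * (\<Prod>i\<in>insert a I. ?N i (p i)))
      = (\<Sum>p\<in>?P - ?Q. of_int (sign p) * (\<Prod>i\<in>insert a I. M i (p i)))"
    unfolding Q by (intro sum.cong refl arg_cong2[where f="(*)"] prod.cong) auto
  show ?thesis
    unfolding split[of M] split[of ?N] 1 2 3 by simp
qed

lemma sub_det_row_zero:
  assumes "finite K" "a \<in> K" "\<And>j. j \<in> K \<Longrightarrow> M a j = 0"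
  shows "sub_det K M = 0"
  unfolding sub_det_def
proof (rule sum.neutral, intro ballI)
  fix p assume "p \<in> {p. p permutes K}"
  then have "M a (p a) = 0"
    using assms by (auto simp: permutes_in_image)
  then show "of_int (sign p) * (\<Prod>i\<in>K. M i (p i)) = 0"
    using assms by (auto intro!: prod_zero)
qed

text \<open>Composing with the transposition of the two rows flips the sign of each term and keeps
  its product, so the sum equals its own negative.\<close>

lemma sub_det_identical_rows:
  assumes "finite K" "a \<in> K" "b \<in> K" "a \<noteq> b" "\<And>j. j \<in> K \<Longrightarrow> M a j = M b j"
  shows "sub_det K M = 0"
proof -
  let ?t = "Transposition.transpose a b"
  have t: "?t permutes K"
    using assms by (simp add: permutes_swap_id)
  have "sub_det K M = (\<Sum>p | p permutes K. of_int (sign (p \<circ> ?t)) * (\<Prod>i\<in>K. M i ((p \<circ> ?t) i)))"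
    unfolding sub_det_def by (rule sum_permutations_compose_right[OF t])
  also have "\<dots> = (\<Sum>p | p permutes K. - (of_int (sign p) * (\<Prod>i\<in>K. M i (p i))))"
  proof (intro sum.cong refl)
    fix p assume p: "p \<in> {p. p permutes K}"
    have "permutation p" "permutation ?t"
      using p \<open>finite K\<close> t by (auto intro: permutes_imp_permutation)
    then have s: "sign (p \<circ> ?t) = - sign p"
      using \<open>a \<noteq> b\<close> by (simp add: sign_compose sign_swap_id)
    have "(\<Prod>i\<in>K. M i ((p \<circ> ?t) i)) = (\<Prod>i\<in>K. M (?t i) ((p \<circ> ?t) (?t i)))"
      by (rule prod.reindex_bij_betw[OF permutes_imp_bij[OF t], symmetric])
    also have "\<dots> = (\<Prod>i\<in>K. M i (p i))"
      using p assms by (intro prod.cong) (auto simp: Transposition.transpose_def permutes_in_image)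
    finally show "of_int (sign (p \<circ> ?t)) * (\<Prod>i\<in>K. M i ((p \<circ> ?t) i)) = - (of_int (sign p) * (\<Prod>i\<in>K. M i (p i)))"
      using s by simp
  qed
  finally show ?thesis
    by (simp add: sum_negf sub_det_def)
qed

lemma sub_det_row_linear:
  assumes "finite I" "finite C" "a \<notin> I"
  shows "sub_det (insert a I) (M(a := \<lambda>j. (\<Sum>k\<in>C. c k * R k j) + r j))
    = (\<Sum>k\<in>C. c k * sub_det (insert a I) (M(a := R k))) + sub_det (insert a I) (M(a := r))"
proof -
  have *: "(\<Prod>i\<in>insert a I. (M(a := s)) i (p i)) = s (p a) * (\<Prod>i\<in>I. M i (p i))" for s p
    using assms by (simp add: prod.insert) (intro disjI2 prod.cong; auto)
  show ?thesis
    unfolding sub_det_def * sum_distrib_left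
    by (subst sum.swap) (simp add: algebra_simps sum.distrib sum_distrib_left sum_distrib_right)
qed

text \<open>Row elimination: each combined row contributes a determinant with two equal rows, and
  what remains of row a is the single diagonal entry s.\<close>

lemma sub_det_insert_row:
  assumes "finite I" "a \<notin> I"
    and row: "\<And>j. j \<in> insert a I \<Longrightarrow> M a j = (\<Sum>i\<in>I. c i * M i j) + (if j = a then s else 0)"
  shows "sub_det (insert a I) M = s * sub_det I M"
proof -
  let ?r = "\<lambda>j. if j = a then s else 0"
  have "sub_det (insert a I) M = sub_det (insert a I) (M(a := \<lambda>j. (\<Sum>i\<in>I. c i * M i j) + ?r j))"
    by (rule sub_det_cong) (use row in auto)
  also have "\<dots> = (\<Sum>i\<in>I. c i * sub_det (insert a I) (M(a := M i))) + sub_det (insert a I) (M(a := ?r))"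
    by (rule sub_det_row_linear) (use assms in auto)
  also have "(\<Sum>i\<in>I. c i * sub_det (insert a I) (M(a := M i))) = 0"
    using assms by (auto intro!: sum.neutral sub_det_identical_rows[of _ a])
  also have "sub_det (insert a I) (M(a := ?r)) = s * sub_det I (M(a := ?r))
      + sub_det (insert a I) (\<lambda>i j. if i = a \<and> j = a then 0 else (M(a := ?r)) i j)"
    using assms by (subst sub_det_insert_split) auto
  also have "sub_det (insert a I) (\<lambda>i j. if i = a \<and> j = a then 0 else (M(a := ?r)) i j) = 0"
    using assms by (intro sub_det_row_zero[of _ a]) auto
  also have "sub_det I (M(a := ?r)) = sub_det I M"
    using assms by (intro sub_det_cong) auto
  finally show ?thesis by simp
qed

text \<open>Each index outside J adds a row whose only entry is a 1 on the diagonal. The identity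
  block will come from the orthonormal rows of an adapted matrix.\<close>

lemma sub_det_extend:
  assumes "finite K" "J \<subseteq> K"
  shows "sub_det K (\<lambda>i j. if i \<in> J \<and> j \<in> J then M i j else if i = j then 1 else 0) = sub_det J M"
proof -
  let ?M = "\<lambda>i j. if i \<in> J \<and> j \<in> J then M i j else if i = j then 1 else (0::real)"
  have "sub_det (J \<union> L) ?M = sub_det J M" if "finite L" "L \<inter> J = {}" for L
    using that
  proof (induction L rule: finite_induct)
    case empty
    then show ?case by (auto intro: sub_det_cong)
  next
    case (insert a L)
    have "finite (J \<union> L)"
      using assms insert by (auto intro: finite_subset)
    then have "sub_det (insert a (J \<union> L)) ?M = 1 * sub_det (J \<union> L) ?M"
      using insert by (intro sub_det_insert_row[where c="\<lambda>_. 0"]) auto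
    with insert show ?case by simp
  qed
  from this[of "K - J"] show ?thesis
    using assms by (auto simp: Un_absorb1 Int_commute)
qed

section \<open>Gram determinants\<close>

abbreviation gram_det :: "'i set \<Rightarrow> ('i \<Rightarrow> 'a::real_inner) \<Rightarrow> real" where
  "gram_det I v \<equiv> sub_det I (\<lambda>i j. v i \<bullet> v j)"

lemma span_image_finite_obtain:
  assumes "finite I" "x \<in> span (v ` I)"
  obtains c where "x = (\<Sum>i\<in>I. c i *\<^sub>R v i)"
proof -
  from assms(2) have "\<exists>c. x = (\<Sum>i\<in>I. c i *\<^sub>R v i)"
  proof (induction rule: span_induct_alt)
    case base
    show ?case by (rule exI[of _ "\<lambda>_. 0"]) simp
  next
    case (step r y x)
    then obtain c i where c: "x = (\<Sum>i\<in>I. c i *\<^sub>R v i)" and i: "i \<in> I" "y = v i"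
      by auto
    have "r *\<^sub>R y + x = (\<Sum>j\<in>I. (c j + (if j = i then r else 0)) *\<^sub>R v j)"
      using i assms(1) by (simp add: c scaleR_add_left sum.distrib if_distrib[of "\<lambda>r. r *\<^sub>R _"] cong: if_cong)
    then show ?case by (rule exI[of _ "\<lambda>j. c j + (if j = i then r else 0)"])
  qed
  then show ?thesis using that by blast
qed

text \<open>Base times squared height: removing from \<open>v a\<close> its part in the span leaves
  row a with the diagonal entry \<open>y \<bullet> y\<close> only.\<close>

lemma gram_det_insert:
  assumes "finite I" "a \<notin> I"
    and span: "v a - y \<in> span (v ` I)" and orth: "\<And>i. i \<in> I \<Longrightarrow> y \<bullet> v i = 0"
  shows "gram_det (insert a I) v = (y \<bullet> y) * gram_det I v"
proof -
  obtain c where c: "v a - y = (\<Sum>i\<in>I. c i *\<^sub>R v i)"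
    using span_image_finite_obtain[OF \<open>finite I\<close> span] .
  then have a: "v a = (\<Sum>i\<in>I. c i *\<^sub>R v i) + y"
    by (simp add: algebra_simps)
  have "y \<bullet> v a = y \<bullet> y"
    by (simp add: a inner_add_right inner_sum_right orth)
  then have "v a \<bullet> v j = (\<Sum>i\<in>I. c i * (v i \<bullet> v j)) + (if j = a then y \<bullet> y else 0)" if "j \<in> insert a I" for j
    using that assms(2) orth
    by (subst a) (auto simp: inner_add_left inner_sum_left)
  then show ?thesis
    using assms by (intro sub_det_insert_row) auto
qed

lemma orthogonal_decomposition_exists:
  fixes S :: "'a::euclidean_space set"
  obtains y where "x - y \<in> span S" "\<And>w. w \<in> span S \<Longrightarrow> y \<bullet> w = 0"
  using orthogonal_subspace_decomp_exists[of S x] by (metis add_diff_cancel_right' orthogonal_def)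

lemma gram_det_nonneg:
  fixes v :: "'i \<Rightarrow> 'a::euclidean_space"
  assumes "finite I"
  shows "0 \<le> gram_det I v"
  using assms
proof (induction I rule: finite_induct)
  case (insert a I)
  obtain y where y: "v a - y \<in> span (v ` I)" "\<And>w. w \<in> span (v ` I) \<Longrightarrow> y \<bullet> w = 0"
    by (rule orthogonal_decomposition_exists[of "v a" "v ` I"]) auto
  then have "gram_det (insert a I) v = (y \<bullet> y) * gram_det I v"
    by (intro gram_det_insert insert) (auto simp: span_base)
  with insert show ?case by simp
qed simp

lemma gram_det_insert_nonzero:
  fixes v :: "'i \<Rightarrow> 'a::euclidean_space"
  assumes "finite I" "a \<notin> I" "gram_det (insert a I) v \<noteq> 0"
  shows "v a \<notin> span (v ` I)" "gram_det I v \<noteq> 0"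
proof -
  show "v a \<notin> span (v ` I)"
    \<comment> \<open>If \<open>v a\<close> were in the span, y = 0 would be its orthogonal part and
      the enlarged determinant would vanish.\<close>
    using gram_det_insert[of I a v 0] assms by auto
  obtain y where y: "v a - y \<in> span (v ` I)" "\<And>w. w \<in> span (v ` I) \<Longrightarrow> y \<bullet> w = 0"
    by (rule orthogonal_decomposition_exists[of "v a" "v ` I"]) auto
  then have "gram_det (insert a I) v = (y \<bullet> y) * gram_det I v"
    by (intro gram_det_insert assms) (auto simp: span_base)
  with assms show "gram_det I v \<noteq> 0" by auto
qed

text \<open>Any index can be taken as the last one added, so no vector lies in the span of the
  others.\<close>

lemma gram_det_nonzero_imp_independent:
  fixes v :: "'i \<Rightarrow> 'a::euclidean_space"
  assumes "finite I" "gram_det I v \<noteq> 0"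
  shows "inj_on v I" "independent (v ` I)"
proof -
  have *: "v a \<notin> span (v ` (I - {a}))" if "a \<in> I" for a
    using gram_det_insert_nonzero(1)[of "I - {a}" a v] that assms by (simp add: insert_absorb)
  show inj: "inj_on v I"
  proof (rule inj_onI, rule ccontr)
    fix a b assume ab: "a \<in> I" "b \<in> I" "v a = v b" "a \<noteq> b"
    then have "v a \<in> v ` (I - {a})" by auto
    with *[OF ab(1)] show False by (simp add: span_base)
  qed
  show "independent (v ` I)"
    unfolding dependent_def using * inj
    by (auto simp: inj_on_image_set_diff[OF inj, of I "{_}", simplified])
qed

section \<open>Lebesgue measure on product spaces\<close>

lemma measurable_vec_lambda [measurable]:
  "(\<lambda>f. \<chi> i. f i) \<in> borel_measurable (PiM UNIV (\<lambda>_::'n::finite. lborel :: 'a::euclidean_space measure))"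
proof -
  have "(\<lambda>f. (\<chi> i. f i) \<bullet> b) \<in> borel_measurable (PiM UNIV (\<lambda>_::'n. lborel :: 'a measure))"
    if Basis: "b \<in> Basis" for b :: "'a ^ 'n"
  proof -
    obtain i c where b: "b = axis i c"
      using Basis unfolding Basis_vec_def by blast
    show ?thesis
      unfolding b inner_axis vec_lambda_beta by measurable
  qed
  then show ?thesis
    by (subst borel_measurable_euclidean_space) auto
qed

lemma prod_Basis_vec:
  "(\<Prod>b\<in>(Basis :: ('a::euclidean_space ^ 'n::finite) set). f b) = (\<Prod>i\<in>UNIV. \<Prod>b\<in>Basis. f (axis i b))"
proof -
  have *: "(Basis :: ('a ^ 'n) set) = (\<lambda>(i, b). axis i b) ` (UNIV \<times> Basis)"
    by (auto simp: Basis_vec_def)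
  have "inj_on (\<lambda>(i, b). axis i b :: 'a ^ 'n) (UNIV \<times> Basis)"
    by (auto simp: inj_on_def axis_eq_axis)
  then show ?thesis
    unfolding * by (subst prod.reindex) (auto simp: prod.cartesian_product case_prod_unfold o_def)
qed

text \<open>Stated for every Euclidean component space, because it is used both for real coordinates
  and for tuples of vectors in \<open>real ^ 'm\<close>.\<close>

lemma lborel_vec_eq_distr_PiM:
  "(lborel :: ('a::euclidean_space ^ 'n::finite) measure)
    = distr (PiM UNIV (\<lambda>_. lborel)) borel (\<lambda>f. \<chi> i. f i)"
proof (rule lborel_eqI)
  interpret product_sigma_finite "\<lambda>_::'n. lborel :: 'a measure"
    by standard
  fix l u :: "'a ^ 'n" assume le: "\<And>b. b \<in> Basis \<Longrightarrow> l \<bullet> b \<le> u \<bullet> b"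
  have le': "l $ i \<bullet> b \<le> u $ i \<bullet> b" if "b \<in> Basis" for i b
    using le[of "axis i b"] that by (simp add: inner_axis axis_in_Basis_iff)
  have "(\<lambda>f. \<chi> i. f i) -` box l u = PiE UNIV (\<lambda>i. box (l $ i) (u $ i))"
    by (rule set_eqI) (simp add: mem_box Basis_vec_def inner_axis PiE_iff)
  then have "emeasure (distr (PiM UNIV (\<lambda>_. lborel)) borel (\<lambda>f. \<chi> i. f i)) (box l u)
      = (\<Prod>i\<in>UNIV. emeasure lborel (box (l $ i) (u $ i)))"
    by (subst emeasure_distr) (auto simp: space_PiM emeasure_PiM)
  also have "\<dots> = (\<Prod>i\<in>UNIV. ennreal (\<Prod>b\<in>Basis. (u - l) $ i \<bullet> b))"
    by (intro prod.cong refl) (simp add: emeasure_lborel_box le')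
  also have "\<dots> = ennreal (\<Prod>i\<in>UNIV. \<Prod>b\<in>Basis. (u - l) $ i \<bullet> b)"
    by (intro prod_ennreal prod_nonneg) (auto simp: inner_diff_left le')
  finally show "emeasure (distr (PiM UNIV (\<lambda>_. lborel)) borel (\<lambda>f. \<chi> i. f i)) (box l u)
      = ennreal (\<Prod>b\<in>Basis. (u - l) \<bullet> b)"
    by (simp add: prod_Basis_vec inner_axis)
qed simp

lemma nn_integral_lborel_vec:
  fixes f :: "'a::euclidean_space ^ 'n::finite \<Rightarrow> ennreal"
  assumes [measurable]: "f \<in> borel_measurable borel"
  shows "(\<integral>\<^sup>+x. f x \<partial>lborel) = (\<integral>\<^sup>+g. f (\<chi> i. g i) \<partial>PiM UNIV (\<lambda>_. lborel))"
  by (subst lborel_vec_eq_distr_PiM) (simp add: nn_integral_distr)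

text \<open>A product of equal factors does not depend on the names of its coordinates, as product
  sets show. This serves for permutation matrices, for placing I among the rows of a matrix, and for
  naming the new off-diagonal pairs by their other index.\<close>

lemma nn_integral_PiM_reindex:
  assumes M: "sigma_finite_measure M" and "finite A" and h: "bij_betw h A B"
    and f: "f \<in> borel_measurable (PiM A (\<lambda>_. M))"
  shows "(\<integral>\<^sup>+x. f (\<lambda>a\<in>A. x (h a)) \<partial>PiM B (\<lambda>_. M)) = (\<integral>\<^sup>+y. f y \<partial>PiM A (\<lambda>_. M))"
proof -
  interpret product_sigma_finite "\<lambda>_. M"
    using M by (simp add: product_sigma_finite_def)
  have B: "B = h ` A" and inj: "inj_on h A"
    using h by (auto simp: bij_betw_def)
  have meas: "(\<lambda>x. \<lambda>a\<in>A. x (h a)) \<in> PiM B (\<lambda>_. M) \<rightarrow>\<^sub>M PiM A (\<lambda>_. M)"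
    by (rule measurable_restrict) (auto simp: B)
  have "distr (PiM B (\<lambda>_. M)) (PiM A (\<lambda>_. M)) (\<lambda>x. \<lambda>a\<in>A. x (h a)) = PiM A (\<lambda>_. M)"
  proof (rule PiM_eqI)
    fix X assume X: "\<And>i. i \<in> A \<Longrightarrow> X i \<in> sets M"
    define Y where "Y b = X (inv_into A h b)" for b
    have Yh: "Y (h a) = X a" if "a \<in> A" for a
      using that inj by (simp add: Y_def)
    have "(\<lambda>x. \<lambda>a\<in>A. x (h a)) -` PiE A X \<inter> space (PiM B (\<lambda>_. M)) = PiE B Y"
    proof (rule set_eqI)
      fix x
      have "(\<forall>a\<in>A. x (h a) \<in> X a \<and> x (h a) \<in> space M) \<longleftrightarrow> (\<forall>a\<in>A. x (h a) \<in> X a)"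
        using sets.sets_into_space[OF X] by blast
      then show "x \<in> (\<lambda>x. \<lambda>a\<in>A. x (h a)) -` PiE A X \<inter> space (PiM B (\<lambda>_. M)) \<longleftrightarrow> x \<in> PiE B Y"
        by (auto simp: space_PiM B Yh PiE_iff)
    qed
    then have "emeasure (distr (PiM B (\<lambda>_. M)) (PiM A (\<lambda>_. M)) (\<lambda>x. \<lambda>a\<in>A. x (h a))) (PiE A X)
        = emeasure (PiM B (\<lambda>_. M)) (PiE B Y)"
      using X \<open>finite A\<close> by (subst emeasure_distr[OF meas]) auto
    also have "\<dots> = (\<Prod>b\<in>B. emeasure M (Y b))"
      using X \<open>finite A\<close> by (intro emeasure_PiM) (auto simp: B Yh)
    also have "\<dots> = (\<Prod>a\<in>A. emeasure M (X a))"
      unfolding B by (subst prod.reindex[OF inj]) (auto simp: Yh)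
    finally show "emeasure (distr (PiM B (\<lambda>_. M)) (PiM A (\<lambda>_. M)) (\<lambda>x. \<lambda>a\<in>A. x (h a))) (PiE A X)
        = (\<Prod>a\<in>A. emeasure M (X a))" .
  qed (use assms in auto)
  then show ?thesis
    using nn_integral_distr[OF meas, of f] f by simp
qed

text \<open>Both sides are compatible with matrix products, so elementary matrices suffice: diagonal
  ones scale the coordinates, swaps rename them, and shears translate one coordinate while the
  others are fixed.\<close>

lemma nn_integral_lborel_linear:
  fixes A :: "real ^ 'n ^ 'n"
  assumes A: "det A \<noteq> 0" and g: "g \<in> borel_measurable borel"
  shows "(\<integral>\<^sup>+y. g y \<partial>lborel) = ennreal \<bar>det A\<bar> * (\<integral>\<^sup>+x. g (A *v x) \<partial>lborel)"
proof -
  interpret product_sigma_finite "\<lambda>_::'n. lborel :: real measure"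
    by standard
  have meas: "(\<lambda>x. B *v x) \<in> borel_measurable borel" for B :: "real ^ 'n ^ 'n"
    by (intro borel_measurable_continuous_onI matrix_vector_mult_linear_continuous_on)
  \<comment> \<open>The condition on the determinant belongs to the predicate: it makes the zero-row
    case vacuous, and from a product it passes to both factors.\<close>
  let ?P = "\<lambda>A :: real ^ 'n ^ 'n. det A \<noteq> 0 \<longrightarrow> (\<forall>g\<in>borel_measurable borel.
    (\<integral>\<^sup>+y. g y \<partial>lborel) = ennreal \<bar>det A\<bar> * (\<integral>\<^sup>+x. g (A *v x) \<partial>lborel))"
  have "?P A"
  proof (rule induct_matrix_elementary[of ?P])
    fix A B :: "real ^ 'n ^ 'n" assume P: "?P A" "?P B"
    show "?P (A ** B)"
    proof (intro impI ballI)
      fix g :: "real ^ 'n \<Rightarrow> ennreal" assume d: "det (A ** B) \<noteq> 0" and g[measurable]: "g \<in> borel_measurable borel"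
      have gA: "(\<lambda>x. g (A *v x)) \<in> borel_measurable borel"
        using measurable_compose[OF meas g] .
      have "(\<integral>\<^sup>+y. g y \<partial>lborel) = ennreal \<bar>det A\<bar> * (\<integral>\<^sup>+x. g (A *v x) \<partial>lborel)"
        using P(1) d g by (simp add: det_mul)
      also have "(\<integral>\<^sup>+x. g (A *v x) \<partial>lborel) = ennreal \<bar>det B\<bar> * (\<integral>\<^sup>+x. g (A *v (B *v x)) \<partial>lborel)"
        using P(2) d gA by (simp add: det_mul)
      finally show "(\<integral>\<^sup>+y. g y \<partial>lborel) = ennreal \<bar>det (A ** B)\<bar> * (\<integral>\<^sup>+x. g (A ** B *v x) \<partial>lborel)"
        by (simp add: det_mul abs_mult ennreal_mult' matrix_vector_mul_assoc mult.assoc)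
    qed
  next
    fix A :: "real ^ 'n ^ 'n" and i assume "row i A = 0"
    then show "?P A" by (simp add: det_zero_row)
  next
    fix A :: "real ^ 'n ^ 'n" assume diag: "\<And>i j. i \<noteq> j \<Longrightarrow> A $ i $ j = 0"
    show "?P A"
    proof (intro impI ballI)
      fix g :: "real ^ 'n \<Rightarrow> ennreal" assume d: "det A \<noteq> 0" and g[measurable]: "g \<in> borel_measurable borel"
      \<comment> \<open>The scaling law takes coefficients indexed by basis vectors; this c has the
        value \<open>A $ i $ i\<close> at \<open>axis i 1\<close>.\<close>
      define c where "c b = (\<Sum>i\<in>UNIV. A $ i $ i * b $ i)" for b :: "real ^ 'n"
      have det: "det A = (\<Prod>i\<in>UNIV. A $ i $ i)"
        by (rule det_diagonal) (rule diag)
      have c: "c (axis i 1) = A $ i $ i" for i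
        by (simp add: c_def axis_def if_distrib cong: if_cong)
      have c0: "c b \<noteq> 0" if "b \<in> Basis" for b
        using that d det c by (auto simp: Basis_vec_def)
      have T: "(\<Sum>j\<in>Basis. (c j * (x \<bullet> j)) *\<^sub>R j) = A *v x" for x
      proof -
        have "(\<Sum>j\<in>Basis. (c j * (x \<bullet> j)) *\<^sub>R j) \<bullet> b = (A *v x) \<bullet> b" if "b \<in> Basis" for b
        proof -
          obtain i where b: "b = axis i 1"
            using \<open>b \<in> Basis\<close> by (auto simp: Basis_vec_def)
          have "(A *v x) $ i = (\<Sum>j\<in>UNIV. if j = i then A $ i $ i * x $ i else 0)"
            unfolding matrix_vector_mult_def vec_lambda_beta by (intro sum.cong refl) (metis (full_types) diag mult_zero_left)
          then show ?thesis
            using that by (simp add: inner_sum_left inner_Basis if_distrib b[symmetric] cong: if_cong)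
              (simp add: b inner_axis c)
        qed
        then show ?thesis by (rule euclidean_eqI)
      qed
      have "(\<Prod>j\<in>(Basis::(real ^ 'n) set). \<bar>c j\<bar>) = \<bar>det A\<bar>"
        by (simp add: prod_Basis_vec c det abs_prod)
      then have "lborel = density (distr lborel borel (\<lambda>x. A *v x)) (\<lambda>_. ennreal \<bar>det A\<bar>)"
        using lborel_affine_euclidean[of c 0] c0 T by (simp add: o_def)
      then have "(\<integral>\<^sup>+y. g y \<partial>lborel) = (\<integral>\<^sup>+y. g y \<partial>density (distr lborel borel (\<lambda>x. A *v x)) (\<lambda>_. ennreal \<bar>det A\<bar>))"
        by simp
      also have "\<dots> = ennreal \<bar>det A\<bar> * (\<integral>\<^sup>+x. g (A *v x) \<partial>lborel)"
        using meas[of A] measurable_compose[OF meas g]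
        by (simp add: nn_integral_density nn_integral_distr nn_integral_cmult)
      finally show "(\<integral>\<^sup>+y. g y \<partial>lborel) = ennreal \<bar>det A\<bar> * (\<integral>\<^sup>+x. g (A *v x) \<partial>lborel)" .
    qed
  next
    fix m n :: 'n assume "m \<noteq> n"
    let ?t = "Transposition.transpose m n"
    let ?A = "(\<chi> i j. mat 1 $ i $ ?t j) :: real ^ 'n ^ 'n"
    have t: "?t permutes UNIV"
      by (simp add: permutes_swap_id)
    have det: "\<bar>det ?A\<bar> = 1"
      using det_permute_columns[OF t, of "mat 1 :: real ^ 'n ^ 'n"]
      by (simp add: abs_mult del: of_int_abs add: of_int_abs[symmetric])
    have Av: "?A *v x = (\<chi> i. x $ ?t i)" for x
    proof -
      have "(\<Sum>j\<in>UNIV. ?A $ i $ j * x $ j) = (\<Sum>j\<in>UNIV. if j = ?t i then x $ j else 0)" for i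
        by (intro sum.cong refl) (auto simp: mat_def Transposition.transpose_def)
      then show ?thesis
        by (simp add: matrix_vector_mult_def)
    qed
    show "?P ?A"
    proof (intro impI ballI)
      fix g :: "real ^ 'n \<Rightarrow> ennreal" assume g[measurable]: "g \<in> borel_measurable borel"
      have "(\<integral>\<^sup>+x. g (?A *v x) \<partial>lborel) = (\<integral>\<^sup>+x. g (?A *v (\<chi> i. x i)) \<partial>PiM UNIV (\<lambda>_. lborel))"
        by (rule nn_integral_lborel_vec) (rule measurable_compose[OF meas g])
      also have "\<dots> = (\<integral>\<^sup>+x. g (\<chi> i. (\<lambda>i\<in>UNIV. x (?t i)) i) \<partial>PiM UNIV (\<lambda>_. lborel))"
        by (simp add: Av)
      also have "\<dots> = (\<integral>\<^sup>+x. g (\<chi> i. x i) \<partial>PiM UNIV (\<lambda>_. lborel))"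
        by (rule nn_integral_PiM_reindex[of lborel UNIV ?t UNIV "\<lambda>x. g (\<chi> i. x i)"])
           (auto intro: permutes_imp_bij t lborel.sigma_finite_measure_axioms)
      also have "\<dots> = (\<integral>\<^sup>+y. g y \<partial>lborel)"
        by (rule nn_integral_lborel_vec[symmetric]) (rule g)
      finally show "(\<integral>\<^sup>+y. g y \<partial>lborel) = ennreal \<bar>det ?A\<bar> * (\<integral>\<^sup>+x. g (?A *v x) \<partial>lborel)"
        by (simp add: det)
    qed
  next
    fix m n :: 'n and c :: real assume mn: "m \<noteq> n"
    let ?A = "(\<chi> i j. if i = m \<and> j = n then c else of_bool (i = j)) :: real ^ 'n ^ 'n"
    have "?A = (\<chi> k. if k = m then row m (mat 1) + c *s row n (mat 1) else row k (mat 1))"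
      using mn by (auto simp: vec_eq_iff row_def mat_def)
    then have det: "det ?A = 1"
      using det_row_operation[OF mn, of "mat 1 :: real ^ 'n ^ 'n" c] by simp
    \<comment> \<open>As an update of coordinate m alone: integrating over that coordinate innermost
      leaves a translation by \<open>c * x n\<close>.\<close>
    have Av: "?A *v (\<chi> i. x i) = (\<chi> i. (x(m := c * x n + 1 * x m)) i)" for x
    proof (subst vec_eq_iff, intro allI)
      fix i
      show "(?A *v (\<chi> i. x i)) $ i = (\<chi> i. (x(m := c * x n + 1 * x m)) i) $ i"
      proof (cases "i = m")
        case True
        have "(?A *v (\<chi> i. x i)) $ i = (\<Sum>j\<in>UNIV. (if j = n then c * x n else 0) + (if j = m then x m else 0))"
          unfolding matrix_vector_mult_def using True mn by (auto intro!: sum.cong)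
        with True show ?thesis by (simp add: sum.distrib)
      next
        case False
        then have "(?A *v (\<chi> i. x i)) $ i = (\<Sum>j\<in>UNIV. (if j = i then x i else 0))"
          unfolding matrix_vector_mult_def by (auto intro!: sum.cong)
        with False show ?thesis by simp
      qed
    qed
    let ?I = "UNIV - {m}"
    have ins: "insert m ?I = UNIV" by auto
    show "?P ?A"
    proof (intro impI ballI)
      fix g :: "real ^ 'n \<Rightarrow> ennreal" assume g[measurable]: "g \<in> borel_measurable borel"
      have gA: "(\<lambda>x. g (?A *v (\<chi> i. x i))) \<in> borel_measurable (PiM UNIV (\<lambda>_. lborel))"
        by (rule measurable_compose[OF measurable_vec_lambda measurable_compose[OF meas g]])
      have gl: "(\<lambda>x. g (\<chi> i. x i)) \<in> borel_measurable (PiM UNIV (\<lambda>_. lborel))"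
        by measurable
      then have gl': "(\<lambda>x. g (\<chi> i. x i)) \<in> borel_measurable (PiM (insert m ?I) (\<lambda>_. lborel))"
        unfolding ins .
      have "(\<integral>\<^sup>+x. g (?A *v x) \<partial>lborel) = (\<integral>\<^sup>+x. g (?A *v (\<chi> i. x i)) \<partial>PiM UNIV (\<lambda>_. lborel))"
        by (rule nn_integral_lborel_vec) (rule measurable_compose[OF meas g])
      also have "\<dots> = (\<integral>\<^sup>+x. \<integral>\<^sup>+r. g (?A *v (\<chi> i. (x(m := r)) i)) \<partial>lborel \<partial>PiM ?I (\<lambda>_. lborel))"
        by (rule product_nn_integral_insert[of ?I m "\<lambda>x. g (?A *v (\<chi> i. x i))", unfolded ins])
           (use gA in auto)
      also have "\<dots> = (\<integral>\<^sup>+x. \<integral>\<^sup>+r. g (\<chi> i. (x(m := c * x n + 1 * r)) i) \<partial>lborel \<partial>PiM ?I (\<lambda>_. lborel))"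
        unfolding Av by (simp only: fun_upd_same fun_upd_other[OF mn[symmetric]] fun_upd_upd)
      also have "\<dots> = (\<integral>\<^sup>+x. \<integral>\<^sup>+r. g (\<chi> i. (x(m := r)) i) \<partial>lborel \<partial>PiM ?I (\<lambda>_. lborel))"
      proof (rule nn_integral_cong)
        fix x :: "'n \<Rightarrow> real" assume x: "x \<in> space (PiM ?I (\<lambda>_. lborel))"
        have M: "(\<lambda>r. g (\<chi> i. (x(m := r)) i)) \<in> borel_measurable borel"
          using measurable_compose[OF measurable_component_update[OF x, of m] gl'] unfolding measurable_lborel2 by blast
        show "(\<integral>\<^sup>+r. g (\<chi> i. (x(m := c * x n + 1 * r)) i) \<partial>lborel) = (\<integral>\<^sup>+r. g (\<chi> i. (x(m := r)) i) \<partial>lborel)"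
          using nn_integral_real_affine[OF M, of 1 "c * x n"] by simp
      qed
      also have "\<dots> = (\<integral>\<^sup>+x. g (\<chi> i. x i) \<partial>PiM UNIV (\<lambda>_. lborel))"
        by (rule product_nn_integral_insert[of ?I m "\<lambda>x. g (\<chi> i. x i)", unfolded ins, symmetric])
           (use gl in auto)
      also have "\<dots> = (\<integral>\<^sup>+y. g y \<partial>lborel)"
        by (rule nn_integral_lborel_vec[symmetric]) (rule g)
      finally show "(\<integral>\<^sup>+y. g y \<partial>lborel) = ennreal \<bar>det ?A\<bar> * (\<integral>\<^sup>+x. g (?A *v x) \<partial>lborel)"
        by (simp add: det)
    qed
  qed
  with A g show ?thesis by blast
qed

text \<open>Density of the squared norm in dimension d. Polar coordinates give Vol(S^(d-1)) r^(d-1)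
  dr, and s = r^2 has dr = ds / (2 r): hence the half and the exponent d/2 - 1.\<close>

definition radial_density :: "nat \<Rightarrow> real \<Rightarrow> real" where
  "radial_density d s = (if s > 0 then vol_sphere (d - 1) / 2 * s powr (real d / 2 - 1) else 0)"

lemma vol_sphere_pos: "vol_sphere n > 0"
  by (auto simp: vol_sphere_def intro!: divide_pos_pos mult_pos_pos Gamma_real_pos)

lemma radial_density_nonneg: "0 \<le> radial_density d s"
  using vol_sphere_pos[of "d - 1"] by (simp add: radial_density_def)

lemma borel_measurable_radial_density [measurable]: "radial_density d \<in> borel_measurable borel"
  unfolding radial_density_def[abs_def] by measurable

lemma vol_sphere_eq_unit_ball_vol:
  assumes "d > 0"
  shows "vol_sphere (d - 1) = real d * unit_ball_vol (real d)"
proof -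
  have G: "Gamma (real d / 2 + 1) = real d / 2 * Gamma (real d / 2)"
    using assms by (intro Gamma_plus1) (auto elim!: nonpos_Ints_cases)
  have "real (d - 1) + 1 = real d"
    using assms by simp
  then show ?thesis
    using assms unfolding vol_sphere_def unit_ball_vol_def G by simp
qed

text \<open>Both measures assign to the half-line up to r the volume of the ball of radius sqrt r
  (nothing for r < 0), and these half-lines determine a measure.\<close>

lemma nn_integral_sum_squares:
  assumes J: "finite J" "J \<noteq> {}" and [measurable]: "g \<in> borel_measurable borel"
  shows "(\<integral>\<^sup>+z. g (\<Sum>j\<in>J. (z j)\<^sup>2) \<partial>PiM J (\<lambda>_. lborel)) = (\<integral>\<^sup>+s. g s * ennreal (radial_density (card J) s) \<partial>lborel)"
proof -
  interpret product_sigma_finite "\<lambda>_. lborel :: real measure"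
    by standard
  let ?d = "card J"
  have d: "?d > 0"
    using J by (simp add: card_gt_0_iff)
  let ?S = "\<lambda>z. \<Sum>j\<in>J. (z j)\<^sup>2 :: real" and ?P = "PiM J (\<lambda>_. lborel :: real measure)"
  have S: "?S \<in> borel_measurable ?P" by measurable
  let ?N = "density lborel (\<lambda>s. ennreal (radial_density ?d s))"
  have le: "emeasure (distr ?P borel ?S) {..r} = ennreal (unit_ball_vol ?d * (max 0 r) powr (?d / 2))" for r
  proof -
    have *: "emeasure (distr ?P borel ?S) {..r} = emeasure ?P (?S -` {..r} \<inter> space ?P)"
      by (subst emeasure_distr[OF S]) auto
    consider "r < 0" | "r = 0" | "r > 0" by linarith
    then show ?thesis
    proof cases
      case 1
      have "0 \<le> ?S z" for z by (intro sum_nonneg) auto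
      then have "?S -` {..r} = {}"
        using 1 by (fastforce dest: order_trans)
      then show ?thesis using 1 * by simp
    next
      case 2
      \<comment> \<open>Radius 0 is treated separately: the sublevel set is one point, which is null
        because J is nonempty.\<close>
      have S0: "?S -` {..0} \<inter> space ?P = PiE J (\<lambda>_. {0})"
      proof (rule set_eqI)
        fix z :: "'a \<Rightarrow> real"
        have "?S z \<le> 0 \<longleftrightarrow> ?S z = 0"
          using sum_nonneg[of J "\<lambda>j. (z j)\<^sup>2"] by auto
        also have "\<dots> \<longleftrightarrow> (\<forall>j\<in>J. z j = 0)"
          using J by (subst sum_nonneg_eq_0_iff) auto
        finally show "z \<in> ?S -` {..0} \<inter> space ?P \<longleftrightarrow> z \<in> PiE J (\<lambda>_. {0})"
          by (auto simp: space_PiM PiE_iff extensional_def fun_eq_iff)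
      qed
      have "emeasure (distr ?P borel ?S) {..r} = (\<Prod>j\<in>J. emeasure lborel {0::real})"
        unfolding 2 *[unfolded 2] S0 by (rule emeasure_PiM) (simp_all add: J)
      then show ?thesis
        using 2 J d by simp
    next
      case 3
      have "?S -` {..r} \<inter> space ?P = {f. sqrt (\<Sum>i\<in>J. (f i)\<^sup>2) \<le> sqrt r} \<inter> space ?P"
        by (auto simp: real_sqrt_le_iff)
      then show ?thesis
        using 3 * emeasure_cball_aux[OF \<open>finite J\<close>, of "sqrt r"]
        by (simp add: powr_half_sqrt[symmetric] powr_powr powr_realpow[symmetric])
    qed
  qed
  have ge: "emeasure ?N {..r} = ennreal (unit_ball_vol ?d * (max 0 r) powr (?d / 2))" for r
  proof -
    have "emeasure ?N {..r} = (\<integral>\<^sup>+s. ennreal (vol_sphere (?d - 1) / 2) * ennreal (s powr (?d / 2 - 1) * indicator {0..max 0 r} s) \<partial>lborel)"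
      using vol_sphere_pos[of "?d - 1"]
      by (subst emeasure_density)
         (auto intro!: nn_integral_cong simp: radial_density_def indicator_def ennreal_mult'[symmetric])
    also have "\<dots> = ennreal (vol_sphere (?d - 1) / 2) * (\<integral>\<^sup>+s. ennreal (s powr (?d / 2 - 1) * indicator {0..max 0 r} s) \<partial>lborel)"
      by (intro nn_integral_cmult) measurable
    also have "(\<integral>\<^sup>+s. ennreal (s powr (?d / 2 - 1) * indicator {0..max 0 r} s) \<partial>lborel) = ennreal (max 0 r powr (?d / 2) / (?d / 2))"
    proof -
      have "((\<lambda>s. s powr (?d / 2 - 1)) has_integral (max 0 r powr (?d / 2) / (?d / 2))) {0..max 0 r}"
        using has_integral_powr_from_0[of "?d / 2 - 1" "max 0 r"] d by simp
      from nn_integral_has_integral_lebesgue[OF _ this] show ?thesis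
        by (simp add: mult.commute[of _ "indicator _ _"])
    qed
    also have "ennreal (vol_sphere (?d - 1) / 2) * \<dots> = ennreal (unit_ball_vol ?d * (max 0 r) powr (?d / 2))"
      using d unfolding vol_sphere_eq_unit_ball_vol[OF d]
      by (subst ennreal_mult'[symmetric]) auto
    finally show ?thesis .
  qed
  have "distr ?P borel ?S = ?N"
  proof (rule measure_eqI_generator_eq[where E="range atMost" and \<Omega>=UNIV and A="\<lambda>n. {..real n}"])
    show "Int_stable (range (atMost :: real \<Rightarrow> _))"
      by (auto simp: Int_stable_def)
    show "(\<Union>i. {..real i}) = UNIV"
      by (auto intro: real_arch_simple)
    show "sets (distr ?P borel ?S) = sigma_sets UNIV (range atMost)" "sets ?N = sigma_sets UNIV (range atMost)"
      by (simp_all add: borel_eq_atMost)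
  qed (auto simp: le ge)
  then have "(\<integral>\<^sup>+z. g z \<partial>distr ?P borel ?S) = (\<integral>\<^sup>+s. g s \<partial>?N)"
    by simp
  then show ?thesis
    by (simp add: nn_integral_distr[OF S] nn_integral_density mult.commute)
qed

section \<open>The joint distribution of inner products and norm\<close>

text \<open>Parseval's identity on the span of a finite orthonormal set.\<close>

lemma orthonormal_expansion_norm:
  fixes y :: "'a::euclidean_space"
  assumes B: "finite B" "pairwise orthogonal B" "\<And>b. b \<in> B \<Longrightarrow> norm b = 1" and y: "y \<in> span B"
  shows "y \<bullet> y = (\<Sum>b\<in>B. (y \<bullet> b)\<^sup>2)"
proof -
  obtain u where u: "y = (\<Sum>b\<in>B. u b *\<^sub>R b)"
    using y span_finite[OF B(1)] by auto
  have "y \<bullet> b = u b" if "b \<in> B" for b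
  proof -
    have "y \<bullet> b = (\<Sum>c\<in>B. if c = b then u b else 0)"
      unfolding u inner_sum_left using B that
      by (intro sum.cong) (auto simp: pairwise_def orthogonal_def dot_square_norm)
    then show ?thesis using B that by simp
  qed
  moreover have "y \<bullet> y = (\<Sum>b\<in>B. u b * (y \<bullet> b))"
    by (subst (2) u) (simp add: inner_sum_right)
  ultimately show ?thesis
    by (simp add: power2_eq_square)
qed

text \<open>The rows of A are the \<open>v i\<close>, placed by an injection h into the row indices,
  and an orthonormal basis of their orthogonal complement. The entries of \<open>A *v x\<close> in
  the latter rows are the coordinates of the part y of x orthogonal to the span, so their squares
  sum to the squared height of x.\<close>

lemma adapted_matrix:
  fixes v :: "'i \<Rightarrow> real ^ 'm"
  assumes I: "finite I" and D: "gram_det I v \<noteq> 0"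
  obtains A :: "real ^ 'm ^ 'm" and h where "inj_on h I" "card I + card (- h ` I) = CARD('m)"
    "\<bar>det A\<bar> = sqrt (gram_det I v)" "\<And>i. i \<in> I \<Longrightarrow> A $ h i = v i"
    "\<And>x. \<exists>y. x - y \<in> span (v ` I) \<and> (\<forall>i\<in>I. y \<bullet> v i = 0) \<and> y \<bullet> y = (\<Sum>j\<in>- h ` I. ((A *v x) $ j)\<^sup>2)"
proof -
  note ind = gram_det_nonzero_imp_independent[OF I D]
  let ?S = "span (v ` I)"
  let ?C = "{y \<in> UNIV. \<forall>x\<in>?S. orthogonal x y}"
  have dimS: "dim ?S = card I"
    using ind by (simp add: dim_eq_card_independent card_image)
  have dimC: "dim ?C + card I = CARD('m)"
    using dim_subspace_orthogonal_to_vectors[of ?S UNIV] dimS by simp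
  have "subspace ?C"
    by (auto simp: subspace_def orthogonal_def inner_add_right)
  then obtain B where B: "B \<subseteq> ?C" "pairwise orthogonal B" "\<And>b. b \<in> B \<Longrightarrow> norm b = 1"
      "independent B" "card B = dim ?C" "span B = ?C"
    by (rule orthonormal_basis_subspace) blast
  have finB: "finite B"
    using B(4) by (rule independent_imp_finite)
  obtain h :: "'i \<Rightarrow> 'm" where h: "inj_on h I"
    using inj_on_iff_card_le[of I "UNIV :: 'm set"] I dimC by auto
  have cardJ: "card I + card (- h ` I) = CARD('m)"
    using card_image[OF h] card_mono[of UNIV "h ` I"] I by (simp add: Compl_eq_Diff_UNIV card_Diff_subset)
  then have "card (- h ` I) = card B"
    using B(5) dimC by simp
  then obtain e where e: "bij_betw e (- h ` I) B"
    using finB finite_same_card_bij[of "- h ` I" B] by auto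
  define A :: "real ^ 'm ^ 'm" where "A = (\<chi> r. if r \<in> h ` I then v (inv_into I h r) else e r)"
  have A1: "A $ h i = v i" if "i \<in> I" for i
    using that h by (simp add: A_def)
  have A2: "A $ r = e r" if "r \<notin> h ` I" for r
    using that by (simp add: A_def)
  have eB: "e r \<in> B" if "r \<notin> h ` I" for r
    using that e by (auto simp: bij_betw_def)
  have ve: "v i \<bullet> e r = 0" if "i \<in> I" "r \<notin> h ` I" for i r
    using eB[OF that(2)] that(1) B(1) by (auto simp: orthogonal_def span_base)
  have ev: "e r \<bullet> v i = 0" if "i \<in> I" "r \<notin> h ` I" for i r
    using ve[OF that] by (simp add: inner_commute)
  have ee: "e r \<bullet> e s = (if r = s then 1 else 0)" if "r \<notin> h ` I" "s \<notin> h ` I" for r s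
  proof (cases "r = s")
    case True
    then show ?thesis
      using B(3)[OF eB[OF that(1)]] by (simp add: dot_square_norm)
  next
    case False
    then have "e r \<noteq> e s"
      using e that by (auto simp: bij_betw_def inj_on_def)
    then show ?thesis
      using B(2) eB[OF that(1)] eB[OF that(2)] False by (auto simp: pairwise_def orthogonal_def)
  qed
  \<comment> \<open>Squaring replaces A by the Gram matrix of its rows, which splits into the Gram
    matrix of v and an identity block.\<close>
  have "(det A)\<^sup>2 = det (A ** transpose A)"
    by (simp add: det_mul det_transpose power2_eq_square)
  also have "\<dots> = sub_det UNIV (\<lambda>r s. A $ r \<bullet> A $ s)"
    unfolding sub_det_UNIV[symmetric]
    by (intro sub_det_cong) (simp add: matrix_matrix_mult_def transpose_def inner_vec_def)
  also have "\<dots> = sub_det UNIV (\<lambda>r s. if r \<in> h ` I \<and> s \<in> h ` I then A $ r \<bullet> A $ s else if r = s then 1 else 0)"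
  proof (rule sub_det_cong)
    fix r s
    show "A $ r \<bullet> A $ s = (if r \<in> h ` I \<and> s \<in> h ` I then A $ r \<bullet> A $ s else if r = s then 1 else 0)"
      by (cases "r \<in> h ` I"; cases "s \<in> h ` I") (auto simp: A1 A2 ve ev ee)
  qed
  also have "\<dots> = sub_det (h ` I) (\<lambda>r s. A $ r \<bullet> A $ s)"
    by (rule sub_det_extend) auto
  also have "\<dots> = sub_det I (\<lambda>i j. A $ h i \<bullet> A $ h j)"
    using I h by (intro sub_det_reindex inj_on_imp_bij_betw)
  also have "\<dots> = gram_det I v"
    by (intro sub_det_cong) (simp add: A1)
  finally have det: "\<bar>det A\<bar> = sqrt (gram_det I v)"
    by (metis real_sqrt_abs)
  have "\<exists>y. x - y \<in> ?S \<and> (\<forall>i\<in>I. y \<bullet> v i = 0) \<and> y \<bullet> y = (\<Sum>j\<in>- h ` I. ((A *v x) $ j)\<^sup>2)" for x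
  proof -
    obtain y where y: "x - y \<in> ?S" "\<And>w. w \<in> ?S \<Longrightarrow> y \<bullet> w = 0"
      by (rule orthogonal_decomposition_exists[of x "v ` I"]) auto
    have "y \<in> span B"
      unfolding B(6) using y(2) by (simp add: orthogonal_def inner_commute)
    then have "y \<bullet> y = (\<Sum>b\<in>B. (y \<bullet> b)\<^sup>2)"
      by (intro orthonormal_expansion_norm finB B)
    also have "\<dots> = (\<Sum>j\<in>- h ` I. (y \<bullet> e j)\<^sup>2)"
      by (rule sum.reindex_bij_betw[OF e, symmetric])
    also have "\<dots> = (\<Sum>j\<in>- h ` I. ((A *v x) $ j)\<^sup>2)"
    proof (intro sum.cong refl arg_cong[where f="\<lambda>t. t\<^sup>2"])
      fix j assume j: "j \<in> - h ` I"
      have "(x - y) \<bullet> e j = 0"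
        using y(1) eB[of j] B(1) j by (auto simp: orthogonal_def)
      then show "y \<bullet> e j = (A *v x) $ j"
        using A2[of j] j by (simp add: matrix_vector_mul_component inner_diff_left inner_commute[of "e j"])
    qed
    finally show ?thesis
      using y by (intro exI[of _ y]) (auto simp: span_base)
  qed
  with that[OF h cardJ det A1] show ?thesis by blast
qed

text \<open>The function q stands for the squared length of the projection of x onto the span, which
  depends on the inner products only. It is abstract here; a quotient of determinants is inserted
  later. The strict bound on \<open>card I\<close> leaves at least one coordinate for the orthogonal
  part.\<close>

lemma nn_integral_inner_products:
  fixes v :: "'i \<Rightarrow> real ^ 'm"
  assumes I: "finite I" "card I < CARD('m)" and D: "gram_det I v \<noteq> 0"
    and q: "\<And>x y. x - y \<in> span (v ` I) \<Longrightarrow> (\<And>i. i \<in> I \<Longrightarrow> y \<bullet> v i = 0)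
      \<Longrightarrow> x \<bullet> x = q (\<lambda>i\<in>I. x \<bullet> v i) + y \<bullet> y"
    and q_meas [measurable]: "q \<in> borel_measurable (PiM I (\<lambda>_. lborel))"
    and g [measurable]: "(\<lambda>(w, t). g w t) \<in> borel_measurable (PiM I (\<lambda>_. lborel) \<Otimes>\<^sub>M borel)"
  shows "(\<integral>\<^sup>+x. g (\<lambda>i\<in>I. x \<bullet> v i) (x \<bullet> x) \<partial>lborel) = ennreal (1 / sqrt (gram_det I v)) *
    (\<integral>\<^sup>+w. \<integral>\<^sup>+t. g w t * ennreal (radial_density (CARD('m) - card I) (t - q w)) \<partial>lborel \<partial>PiM I (\<lambda>_. lborel))"
proof -
  interpret product_sigma_finite "\<lambda>_::'m. lborel :: real measure"
    by standard
  obtain A :: "real ^ 'm ^ 'm" and h where h: "inj_on h I" and cardJ: "card I + card (- h ` I) = CARD('m)"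
    and det: "\<bar>det A\<bar> = sqrt (gram_det I v)" and Ah: "\<And>i. i \<in> I \<Longrightarrow> A $ h i = v i"
    and dec: "\<And>x. \<exists>y. x - y \<in> span (v ` I) \<and> (\<forall>i\<in>I. y \<bullet> v i = 0) \<and> y \<bullet> y = (\<Sum>j\<in>- h ` I. ((A *v x) $ j)\<^sup>2)"
    by (rule adapted_matrix[OF I(1) D]) blast
  define K J where "K = h ` I" and "J = - K"
  have KJ: "K \<inter> J = {}" "finite K" "finite J" "K \<union> J = UNIV" "J \<noteq> {}"
    using cardJ I by (auto simp: K_def J_def)
  have cJ: "card J = CARD('m) - card I"
    using cardJ by (simp add: K_def J_def)
  have hK: "bij_betw h I K"
    using h by (simp add: K_def inj_on_imp_bij_betw)
  have hi: "h i \<in> K" if "i \<in> I" for i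
    using that by (simp add: K_def)
  \<comment> \<open>H takes the squared height s in place of the squared norm
    \<open>q w + s\<close>. The integrand then depends on the coordinates in K and on the sum of
    squares over J.\<close>
  define H where "H w s = g w (q w + s)" for w s
  have [measurable]: "(\<lambda>(w, s). H w s) \<in> borel_measurable (PiM I (\<lambda>_. lborel) \<Otimes>\<^sub>M borel)"
    unfolding H_def by measurable
  define G where "G y = H (\<lambda>i\<in>I. y (h i)) (\<Sum>j\<in>J. (y j)\<^sup>2)" for y
  have [measurable]: "(\<lambda>y. \<lambda>i\<in>I. y (h i)) \<in> PiM K (\<lambda>_. lborel) \<rightarrow>\<^sub>M PiM I (\<lambda>_. lborel :: real measure)"
    by (rule measurable_restrict) (auto simp: hi)
  have [measurable]: "(\<lambda>y. \<lambda>i\<in>I. y (h i)) \<in> PiM UNIV (\<lambda>_. lborel) \<rightarrow>\<^sub>M PiM I (\<lambda>_. lborel :: real measure)"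
    by (rule measurable_restrict) auto
  have G [measurable]: "G \<in> borel_measurable (PiM UNIV (\<lambda>_. lborel))"
    unfolding G_def by measurable
  have [measurable]: "(\<lambda>y::real^'m. \<lambda>i\<in>I. y $ h i) \<in> borel \<rightarrow>\<^sub>M PiM I (\<lambda>_. lborel :: real measure)"
    by (rule measurable_restrict) auto
  have G' [measurable]: "(\<lambda>y :: real ^ 'm. G (($) y)) \<in> borel_measurable borel"
    unfolding G_def by measurable
  have "g (\<lambda>i\<in>I. x \<bullet> v i) (x \<bullet> x) = G (($) (A *v x))" for x
  proof -
    have *: "(\<lambda>i\<in>I. x \<bullet> v i) = (\<lambda>i\<in>I. (A *v x) $ h i)"
      by (auto simp: fun_eq_iff matrix_vector_mul_component Ah inner_commute)
    obtain y where "x - y \<in> span (v ` I)" "\<forall>i\<in>I. y \<bullet> v i = 0" "y \<bullet> y = (\<Sum>j\<in>J. ((A *v x) $ j)\<^sup>2)"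
      using dec[of x] by (auto simp: J_def K_def)
    with q[of x y] have "x \<bullet> x = q (\<lambda>i\<in>I. (A *v x) $ h i) + (\<Sum>j\<in>J. ((A *v x) $ j)\<^sup>2)"
      by (simp add: *)
    then show ?thesis
      by (simp add: G_def H_def *)
  qed
  then have "(\<integral>\<^sup>+x. g (\<lambda>i\<in>I. x \<bullet> v i) (x \<bullet> x) \<partial>lborel) = (\<integral>\<^sup>+x. G (($) (A *v x)) \<partial>lborel)"
    by simp
  also have "\<dots> = ennreal (1 / \<bar>det A\<bar>) * (\<integral>\<^sup>+y. G (($) y) \<partial>lborel)"
  proof -
    have "det A \<noteq> 0" using det D by auto
    then show ?thesis
      by (subst nn_integral_lborel_linear[OF _ G', of A])
         (auto simp: mult.assoc[symmetric] ennreal_mult'[symmetric])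
  qed
  also have "(\<integral>\<^sup>+y. G (($) y) \<partial>lborel) = (\<integral>\<^sup>+y. G y \<partial>PiM (K \<union> J) (\<lambda>_. lborel))"
  proof -
    have "($) (vec_lambda f) = f" for f :: "'m \<Rightarrow> real"
      by (simp add: fun_eq_iff)
    then show ?thesis
      by (subst nn_integral_lborel_vec) (simp_all add: KJ)
  qed
  also have "\<dots> = (\<integral>\<^sup>+a. \<integral>\<^sup>+b. G (merge K J (a, b)) \<partial>PiM J (\<lambda>_. lborel) \<partial>PiM K (\<lambda>_. lborel))"
    using KJ G by (intro product_nn_integral_fold) auto
  also have "\<dots> = (\<integral>\<^sup>+a. \<integral>\<^sup>+b. H (\<lambda>i\<in>I. a (h i)) (\<Sum>j\<in>J. (b j)\<^sup>2) \<partial>PiM J (\<lambda>_. lborel) \<partial>PiM K (\<lambda>_. lborel))"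
  proof (intro nn_integral_cong)
    fix a b :: "'m \<Rightarrow> real"
    have "(\<lambda>i\<in>I. merge K J (a, b) (h i)) = (\<lambda>i\<in>I. a (h i))"
      by (auto simp: fun_eq_iff hi merge_def)
    moreover have "(\<Sum>j\<in>J. (merge K J (a, b) j)\<^sup>2) = (\<Sum>j\<in>J. (b j)\<^sup>2)"
      using KJ by (intro sum.cong) auto
    ultimately show "G (merge K J (a, b)) = H (\<lambda>i\<in>I. a (h i)) (\<Sum>j\<in>J. (b j)\<^sup>2)"
      by (simp add: G_def)
  qed
  also have "\<dots> = (\<integral>\<^sup>+a. (\<integral>\<^sup>+s. H (\<lambda>i\<in>I. a (h i)) s * ennreal (radial_density (card J) s) \<partial>lborel) \<partial>PiM K (\<lambda>_. lborel))"
  proof (intro nn_integral_cong nn_integral_sum_squares)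
    fix a :: "'m \<Rightarrow> real" assume a: "a \<in> space (PiM K (\<lambda>_. lborel))"
    then have "(\<lambda>i\<in>I. a (h i)) \<in> space (PiM I (\<lambda>_. lborel :: real measure))"
      by (auto simp: space_PiM)
    then show "H (\<lambda>i\<in>I. a (h i)) \<in> borel_measurable borel"
      using measurable_Pair2[of "\<lambda>(w, s). H w s" "PiM I (\<lambda>_. lborel)" borel borel] by simp
  qed (use KJ in auto)
  also have "\<dots> = (\<integral>\<^sup>+w. (\<integral>\<^sup>+s. H w s * ennreal (radial_density (card J) s) \<partial>lborel) \<partial>PiM I (\<lambda>_. lborel))"
    by (rule nn_integral_PiM_reindex[OF lborel.sigma_finite_measure_axioms I(1) hK,
        of "\<lambda>w. \<integral>\<^sup>+s. H w s * ennreal (radial_density (card J) s) \<partial>lborel"]) measurable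
  \<comment> \<open>The translation t = q w + s returns from the squared height to the squared
    norm.\<close>
  also have "\<dots> = (\<integral>\<^sup>+w. (\<integral>\<^sup>+t. g w t * ennreal (radial_density (card J) (t - q w)) \<partial>lborel) \<partial>PiM I (\<lambda>_. lborel))"
  proof (rule nn_integral_cong)
    fix w :: "'i \<Rightarrow> real" assume w: "w \<in> space (PiM I (\<lambda>_. lborel))"
    then have [measurable]: "g w \<in> borel_measurable borel"
      using measurable_Pair2[OF g w] by simp
    show "(\<integral>\<^sup>+s. H w s * ennreal (radial_density (card J) s) \<partial>lborel)
        = (\<integral>\<^sup>+t. g w t * ennreal (radial_density (card J) (t - q w)) \<partial>lborel)"
      using nn_integral_real_affine[of "\<lambda>t. g w t * ennreal (radial_density (card J) (t - q w))" 1 "q w"]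
      by (simp add: H_def)
  qed
  finally show ?thesis
    unfolding det cJ .
qed

section \<open>The density on partial Gram matrices\<close>

definition pairs :: "'k set \<Rightarrow> 'k uprod set" where
  "pairs I = {p. set_uprod p \<subseteq> I}"

lemma Upair_in_pairs [simp]: "Upair i j \<in> pairs I \<longleftrightarrow> i \<in> I \<and> j \<in> I"
  by (simp add: pairs_def)

lemma pairs_UNIV [simp]: "pairs UNIV = UNIV"
  by (simp add: pairs_def)

lemma pairs_empty [simp]: "pairs {} = {}"
proof (intro equalityI subsetI)
  fix p :: "'a uprod" assume "p \<in> pairs {}"
  then show "p \<in> {}" by (cases p) simp
qed simp

lemma finite_pairs [simp]: "finite (pairs (I :: 'k::finite set))"
  by (rule finite_subset[of _ UNIV]) auto

lemma pairs_insert: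
  "pairs (insert a I) = pairs I \<union> insert (Upair a a) (Upair a ` I)"
proof (intro set_eqI)
  fix p
  show "p \<in> pairs (insert a I) \<longleftrightarrow> p \<in> pairs I \<union> insert (Upair a a) (Upair a ` I)"
    by (cases p) auto
qed

abbreviation udet :: "'k set \<Rightarrow> ('k uprod \<Rightarrow> real) \<Rightarrow> real" where
  "udet I u \<equiv> sub_det I (\<lambda>i j. u (Upair i j))"

text \<open>The determinant condition selects the Gram matrices of independent tuples. Only the
  values of u on \<open>pairs I\<close> are constrained, so the same u can be tested against growing
  index sets.\<close>

definition gram_region :: "'m::finite itself \<Rightarrow> 'k set \<Rightarrow> ('k uprod \<Rightarrow> real) set" where
  "gram_region TYPE('m) I =
    {u. udet I u > 0 \<and> (\<exists>v :: 'k \<Rightarrow> real ^ 'm. \<forall>i\<in>I. \<forall>j\<in>I. u (Upair i j) = v i \<bullet> v j)}"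

text \<open>If independent vectors realise the block on I, a positive next determinant D' suffices
  for one more vector: take x with the prescribed inner products and squared height D'/D. The bound
  on \<open>card I\<close> provides a direction orthogonal to the span.\<close>

lemma gram_region_insert:
  assumes I: "finite I" "a \<notin> I" "card I < CARD('m::finite)"
  shows "u \<in> gram_region TYPE('m) (insert a I) \<longleftrightarrow> u \<in> gram_region TYPE('m) I \<and> udet (insert a I) u > 0"
proof
  assume u: "u \<in> gram_region TYPE('m) (insert a I)"
  then obtain v :: "'a \<Rightarrow> real ^ 'm" where
    v: "\<And>i j. i \<in> insert a I \<Longrightarrow> j \<in> insert a I \<Longrightarrow> u (Upair i j) = v i \<bullet> v j"
    unfolding gram_region_def by blast
  have "udet (insert a I) u = gram_det (insert a I) v" "udet I u = gram_det I v"
    by (intro sub_det_cong v; simp)+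
  with u gram_det_insert_nonzero(2)[OF I(1,2), of v] gram_det_nonneg[OF I(1), of v] v
  show "u \<in> gram_region TYPE('m) I \<and> udet (insert a I) u > 0"
    unfolding gram_region_def by (auto simp: less_le)
next
  assume u: "u \<in> gram_region TYPE('m) I \<and> udet (insert a I) u > 0"
  then obtain v :: "'a \<Rightarrow> real ^ 'm" where
    v: "\<And>i j. i \<in> I \<Longrightarrow> j \<in> I \<Longrightarrow> u (Upair i j) = v i \<bullet> v j"
    unfolding gram_region_def by blast
  define D D' where "D = gram_det I v" and "D' = udet (insert a I) u"
  have uD: "udet I u = D"
    unfolding D_def by (intro sub_det_cong v)
  have D: "D > 0" and D': "D' > 0"
    using u uD by (auto simp: gram_region_def D'_def)
  obtain A :: "real ^ 'm ^ 'm" and h where h: "inj_on h I" and cardJ: "card I + card (- h ` I) = CARD('m)"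
    and det: "\<bar>det A\<bar> = sqrt D" and Ah: "\<And>i. i \<in> I \<Longrightarrow> A $ h i = v i"
    and dec: "\<And>x. \<exists>y. x - y \<in> span (v ` I) \<and> (\<forall>i\<in>I. y \<bullet> v i = 0) \<and> y \<bullet> y = (\<Sum>j\<in>- h ` I. ((A *v x) $ j)\<^sup>2)"
    using D unfolding D_def by - (rule adapted_matrix[OF I(1), of v], simp, blast)
  have "- h ` I \<noteq> {}"
    using cardJ I(3) by auto
  then obtain r0 where r0: "r0 \<notin> h ` I" by auto
  \<comment> \<open>The image of the new vector under A: prescribed inner products in the rows of I,
    and the whole height in one spare row r0.\<close>
  define z :: "real ^ 'm" where
    "z = (\<chi> r. if r \<in> h ` I then u (Upair a (inv_into I h r)) else if r = r0 then sqrt (D' / D) else 0)"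
  have "invertible A"
    using det D by (auto simp: invertible_det_nz)
  then obtain B where "A ** B = mat 1"
    by (auto simp: invertible_def)
  then have Az: "A *v (B *v z) = z"
    by (simp add: matrix_vector_mul_assoc)
  define x where "x = B *v z"
  have Ax: "A *v x = z"
    by (simp add: x_def Az)
  have xv: "x \<bullet> v i = u (Upair a i)" if "i \<in> I" for i
  proof -
    have "x \<bullet> v i = (A *v x) $ h i"
      by (simp add: matrix_vector_mul_component Ah that inner_commute)
    also have "\<dots> = u (Upair a i)"
      unfolding Ax using that h by (simp add: z_def)
    finally show ?thesis .
  qed
  obtain y where y: "x - y \<in> span (v ` I)" "\<And>i. i \<in> I \<Longrightarrow> y \<bullet> v i = 0"
      "y \<bullet> y = (\<Sum>j\<in>- h ` I. (z $ j)\<^sup>2)"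
    using dec[of x] by (auto simp: Ax)
  have "(\<Sum>j\<in>- h ` I. (z $ j)\<^sup>2) = (\<Sum>j\<in>- h ` I. if j = r0 then D' / D else 0)"
    using D D' by (intro sum.cong) (auto simp: z_def)
  then have yy: "y \<bullet> y = D' / D"
    using y(3) r0 by simp
  define v' where "v' = v(a := x)"
  have v'a: "v' a = x" and v'I: "v' i = v i" if "i \<in> I" for i
    using that I by (auto simp: v'_def)
  have im: "v' ` I = v ` I"
    using v'I by auto
  have gI: "gram_det I v' = D"
    unfolding D_def by (intro sub_det_cong) (simp add: v'I)
  have "gram_det (insert a I) v' = (y \<bullet> y) * gram_det I v'"
    using y I by (intro gram_det_insert) (simp_all add: v'I im, simp add: v'_def)
  then have D'eq: "gram_det (insert a I) v' = D'"
    using D by (simp add: gI yy)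
  have off: "u (Upair i j) = v' i \<bullet> v' j" if ij: "i \<in> insert a I" "j \<in> insert a I" "i \<noteq> a \<or> j \<noteq> a" for i j
  proof -
    consider "i \<in> I" "j \<in> I" | "i = a" "j \<in> I" | "i \<in> I" "j = a"
      using ij by auto
    then show ?thesis
    proof cases
      case 3
      have "u (Upair i j) = u (Upair a i)"
        unfolding 3 by (rule arg_cong[of _ _ u]) simp
      also have "\<dots> = v' i \<bullet> v' j"
        using 3 xv[of i] I by (auto simp: v'_def inner_commute)
      finally show ?thesis .
    qed (use v xv I in \<open>auto simp: v'_def\<close>)
  qed
  \<comment> \<open>Apart from the corner entry at a the two matrices agree, and both have
    determinant D'. The determinant is affine in the corner entry with slope D > 0, so the corner
    entries agree too.\<close>
  have "sub_det (insert a I) (\<lambda>i j. if i = a \<and> j = a then 0 else u (Upair i j))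
      = sub_det (insert a I) (\<lambda>i j. if i = a \<and> j = a then 0 else v' i \<bullet> v' j)"
    using off by (intro sub_det_cong) auto
  then have "u (Upair a a) * D = (v' a \<bullet> v' a) * D"
    using sub_det_insert_split[OF I(1,2), of "\<lambda>i j. u (Upair i j)"]
      sub_det_insert_split[OF I(1,2), of "\<lambda>i j. v' i \<bullet> v' j"] D'eq
    by (simp add: uD gI D'_def)
  then have "u (Upair a a) = v' a \<bullet> v' a"
    using D by simp
  then have "\<forall>i\<in>insert a I. \<forall>j\<in>insert a I. u (Upair i j) = v' i \<bullet> v' j"
    using off by blast
  then show "u \<in> gram_region TYPE('m) (insert a I)"
    using u by (auto simp: gram_region_def)
qed

abbreviation PiR :: "'i set \<Rightarrow> ('i \<Rightarrow> real) measure" where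
  "PiR A \<equiv> PiM A (\<lambda>_. lborel)"

lemma sub_det_measurable:
  assumes "finite I" "\<And>i j. i \<in> I \<Longrightarrow> j \<in> I \<Longrightarrow> (\<lambda>x. M x i j) \<in> borel_measurable N"
  shows "(\<lambda>x. sub_det I (M x)) \<in> borel_measurable N"
  unfolding sub_det_def
  using assms by (intro borel_measurable_sum borel_measurable_times borel_measurable_const borel_measurable_prod)
    (auto simp: permutes_in_image)

lemma measurable_udet:
  assumes "finite I"
  shows "udet I \<in> borel_measurable (PiR (pairs I))"
  using assms by (intro sub_det_measurable)
    (auto intro: measurable_compose[OF measurable_component_singleton] simp: measurable_lborel1)

lemma measurable_restrict_pairs:
  assumes "I \<subseteq> J"
  shows "(\<lambda>u. restrict u (pairs I)) \<in> PiR (pairs J) \<rightarrow>\<^sub>M PiR (pairs I)"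
  using assms by (intro measurable_restrict_subset) (auto simp: pairs_def)

lemma gram_region_restrict: "restrict u (pairs I) \<in> gram_region TYPE('m::finite) I \<longleftrightarrow> u \<in> gram_region TYPE('m) I"
proof -
  have "udet I (restrict u (pairs I)) = udet I u"
    by (intro sub_det_cong) simp
  then show ?thesis by (simp add: gram_region_def)
qed

text \<open>The existential quantifier over vectors does not show measurability; by
  \<open>gram_region_insert\<close> the region is cut out by positive determinants along a chain of
  index sets.\<close>

lemma gram_region_measurable:
  assumes "finite I" "card I \<le> CARD('m::finite)"
  shows "Measurable.pred (PiR (pairs I)) (\<lambda>u. u \<in> gram_region TYPE('m) I)"
  using assms
proof (induction I rule: finite_induct)
  case empty
  then show ?case by (simp add: gram_region_def)
next
  case (insert a I)
  have [measurable]: "udet (insert a I) \<in> borel_measurable (PiR (pairs (insert a I)))"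
    using insert by (intro measurable_udet) auto
  have "Measurable.pred (PiR (pairs (insert a I))) (\<lambda>u. restrict u (pairs I) \<in> gram_region TYPE('m) I)"
    using insert by (intro measurable_compose[OF measurable_restrict_pairs[OF subset_insertI]]) auto
  then have [measurable]: "Measurable.pred (PiR (pairs (insert a I))) (\<lambda>u. u \<in> gram_region TYPE('m) I)"
    by (simp add: gram_region_restrict)
  have "Measurable.pred (PiR (pairs (insert a I))) (\<lambda>u. u \<in> gram_region TYPE('m) I \<and> 0 < udet (insert a I) u)"
    by measurable
  then show ?case
    using insert by (simp add: gram_region_insert)
qed

definition gram_weight :: "'m::finite itself \<Rightarrow> 'k set \<Rightarrow> ('k uprod \<Rightarrow> real) \<Rightarrow> real" where
  "gram_weight TYPE('m) I u = (if u \<in> gram_region TYPE('m) I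
     then udet I u powr ((real CARD('m) - real (card I) - 1) / 2) else 0)"

lemma gram_weight_nonneg: "0 \<le> gram_weight TYPE('m::finite) I u"
  by (simp add: gram_weight_def)

lemma measurable_gram_weight:
  assumes "finite I" "card I \<le> CARD('m::finite)"
  shows "gram_weight TYPE('m) I \<in> borel_measurable (PiR (pairs I))"
proof -
  note [measurable] = gram_region_measurable[OF assms] measurable_udet[OF assms(1)]
  show ?thesis
    unfolding gram_weight_def[abs_def] by measurable
qed

text \<open>The exponents match because the Schur complement of the block \<open>I\<close> is a quotient of two determinants.\<close>

lemma gram_weight_insert:
  assumes I: "finite I" "a \<notin> I" "card I < CARD('m::finite)"
  defines "d \<equiv> CARD('m) - card I"
  shows "gram_weight TYPE('m) I u * (1 / sqrt (udet I u)) * radial_density d (udet (insert a I) u / udet I u)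
    = vol_sphere (d - 1) / 2 * gram_weight TYPE('m) (insert a I) u"
proof (cases "u \<in> gram_region TYPE('m) (insert a I)")
  case True
  then have uI: "u \<in> gram_region TYPE('m) I" and D': "udet (insert a I) u > 0"
    using gram_region_insert[OF I] by blast+
  define D D' where "D = udet I u" and "D' = udet (insert a I) u"
  have D: "D > 0" and "D' > 0"
    using uI D' by (auto simp: gram_region_def D_def D'_def)
  have "D powr ((real d - 1) / 2) * (1 / sqrt D) = D powr (real d / 2 - 1)"
    using D by (simp add: powr_half_sqrt[symmetric] powr_diff[symmetric] diff_divide_distrib)
  then have *: "D powr ((real d - 1) / 2) * (1 / sqrt D) * (D' / D) powr (real d / 2 - 1) = D' powr ((real d - 2) / 2)"
    using D \<open>D' > 0\<close> by (simp add: powr_divide diff_divide_distrib)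
  have "real CARD('m) - real (card I) - 1 = real d - 1"
      "real CARD('m) - real (card (insert a I)) - 1 = real d - 2"
    using I by (simp_all add: d_def)
  then have W: "gram_weight TYPE('m) I u = D powr ((real d - 1) / 2)"
      "gram_weight TYPE('m) (insert a I) u = D' powr ((real d - 2) / 2)"
    using True uI by (simp_all only: gram_weight_def if_True D_def D'_def)
  have R: "radial_density d (D' / D) = vol_sphere (d - 1) / 2 * (D' / D) powr (real d / 2 - 1)"
    using D \<open>D' > 0\<close> by (simp add: radial_density_def)
  show ?thesis
    unfolding W R D_def[symmetric] D'_def[symmetric] *[symmetric] by (simp only: mult_ac)
next
  case False
  then consider "u \<notin> gram_region TYPE('m) I" | "udet I u > 0" "udet (insert a I) u \<le> 0"
    using gram_region_insert[OF I, of u] by (auto simp: not_less) (auto simp: gram_region_def)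
  then show ?thesis
    using False by cases (auto simp: gram_weight_def radial_density_def zero_less_divide_iff)
qed

text \<open>The symmetric matrix with old block u, new row w and new corner t. An unordered pair
  does not say which of its members is a; \<open>inv_into I (Upair a)\<close> reads off the other
  one.\<close>

definition border :: "'k set \<Rightarrow> 'k \<Rightarrow> ('k uprod \<Rightarrow> real) \<Rightarrow> ('k \<Rightarrow> real) \<Rightarrow> real \<Rightarrow> 'k uprod \<Rightarrow> real" where
  "border I a u w t = (\<lambda>p\<in>pairs (insert a I). if p \<in> pairs I then u p
     else if p = Upair a a then t else w (inv_into I (Upair a) p))"

lemma inj_on_Upair: "inj_on (Upair a) I"
  by (auto simp: inj_on_def)

lemma border_simps:
  assumes "a \<notin> I"
  shows "i \<in> I \<Longrightarrow> j \<in> I \<Longrightarrow> border I a u w t (Upair i j) = u (Upair i j)"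
    "border I a u w t (Upair a a) = t"
    "i \<in> I \<Longrightarrow> border I a u w t (Upair a i) = w i"
    "i \<in> I \<Longrightarrow> border I a u w t (Upair i a) = w i"
proof -
  show 1: "i \<in> I \<Longrightarrow> border I a u w t (Upair a i) = w i" for i
    using assms by (auto simp: border_def inv_into_f_f[OF inj_on_Upair])
  have "Upair i a = Upair a i" by simp
  then show "i \<in> I \<Longrightarrow> border I a u w t (Upair i a) = w i"
    using 1 by metis
qed (use assms in \<open>auto simp: border_def\<close>)

lemma measurable_border:
  assumes "a \<notin> I"
    and u: "(\<lambda>x. fu x) \<in> N \<rightarrow>\<^sub>M PiR (pairs I)" and w: "fw \<in> N \<rightarrow>\<^sub>M PiR I" and t: "ft \<in> borel_measurable N"
  shows "(\<lambda>x. border I a (fu x) (fw x) (ft x)) \<in> N \<rightarrow>\<^sub>M PiR (pairs (insert a I))"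
  unfolding border_def
proof (rule measurable_restrict)
  fix p assume p: "p \<in> pairs (insert a I)"
  then consider "p \<in> pairs I" | "p \<notin> pairs I" "p = Upair a a" | i where "p \<notin> pairs I" "p \<noteq> Upair a a" "i \<in> I" "p = Upair a i"
    unfolding pairs_insert by blast
  then show "(\<lambda>x. if p \<in> pairs I then fu x p else if p = Upair a a then ft x else fw x (inv_into I (Upair a) p))
      \<in> N \<rightarrow>\<^sub>M lborel"
  proof cases
    case 1
    then show ?thesis
      using measurable_compose[OF u measurable_component_singleton[OF 1]] by simp
  next
    case 2
    then show ?thesis using t by simp
  next
    case 3
    then show ?thesis
      using measurable_compose[OF w measurable_component_singleton[OF 3(3)]]
      by (simp add: inv_into_f_f[OF inj_on_Upair] del: Upair_in_pairs)
  qed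
qed

text \<open>Tonelli over three groups of coordinates: the old pairs, the pairs of a with an old
  index, and the pair of a with itself. The middle group is renamed by the old index, so that w can
  be a tuple of inner products.\<close>

lemma nn_integral_border:
  fixes I :: "'k::finite set"
  assumes a: "a \<notin> I" and F: "F \<in> borel_measurable (PiR (pairs (insert a I)))"
  shows "(\<integral>\<^sup>+u. F u \<partial>PiR (pairs (insert a I)))
    = (\<integral>\<^sup>+u. \<integral>\<^sup>+w. \<integral>\<^sup>+t. F (border I a u w t) \<partial>lborel \<partial>PiR I \<partial>PiR (pairs I))"
proof -
  interpret product_sigma_finite "\<lambda>_::'k uprod. lborel :: real measure"
    by standard
  let ?Q = "Upair a ` I" and ?h = "inv_into I (Upair a)"
  have h: "bij_betw ?h ?Q I"
    by (rule bij_betw_inv_into) (auto simp: inj_on_Upair inj_on_imp_bij_betw)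
  have "(\<integral>\<^sup>+u. F u \<partial>PiR (pairs (insert a I)))
      = (\<integral>\<^sup>+u. \<integral>\<^sup>+z. F (merge (pairs I) (insert (Upair a a) ?Q) (u, z)) \<partial>PiR (insert (Upair a a) ?Q) \<partial>PiR (pairs I))"
    using a F unfolding pairs_insert by (intro product_nn_integral_fold) auto
  also have "\<dots> = (\<integral>\<^sup>+u. \<integral>\<^sup>+w. \<integral>\<^sup>+t. F (border I a u w t) \<partial>lborel \<partial>PiR I \<partial>PiR (pairs I))"
  proof (rule nn_integral_cong)
    fix u assume u: "u \<in> space (PiR (pairs I))"
    let ?m = "\<lambda>z. merge (pairs I) (insert (Upair a a) ?Q) (u, z)"
    have m: "?m \<in> PiR (insert (Upair a a) ?Q) \<rightarrow>\<^sub>M PiR (pairs (insert a I))"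
      unfolding pairs_insert
      by (rule measurable_compose[OF measurable_Pair1'[OF u] measurable_merge])
    note Fm = measurable_compose[OF m F]
    have upd: "(\<lambda>(z, t). z(Upair a a := t)) \<in> PiR ?Q \<Otimes>\<^sub>M lborel \<rightarrow>\<^sub>M PiR (insert (Upair a a) ?Q)"
      by (rule measurable_add_dim)
    have "(\<integral>\<^sup>+z. F (?m z) \<partial>PiR (insert (Upair a a) ?Q)) = (\<integral>\<^sup>+z. \<integral>\<^sup>+t. F (?m (z(Upair a a := t))) \<partial>lborel \<partial>PiR ?Q)"
      using a by (intro product_nn_integral_insert Fm) auto
    also have "\<dots> = (\<integral>\<^sup>+w. \<integral>\<^sup>+t. F (?m ((\<lambda>p\<in>?Q. w (?h p))(Upair a a := t))) \<partial>lborel \<partial>PiR I)"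
    proof (rule nn_integral_PiM_reindex[OF lborel.sigma_finite_measure_axioms _ h, symmetric,
        of "\<lambda>z. \<integral>\<^sup>+t. F (?m (z(Upair a a := t))) \<partial>lborel"])
      show "(\<lambda>z. \<integral>\<^sup>+t. F (?m (z(Upair a a := t))) \<partial>lborel) \<in> borel_measurable (PiR ?Q)"
        using measurable_compose[OF upd Fm]
        by (intro lborel.borel_measurable_nn_integral) (simp add: case_prod_unfold)
    qed simp
    also have "\<dots> = (\<integral>\<^sup>+w. \<integral>\<^sup>+t. F (border I a u w t) \<partial>lborel \<partial>PiR I)"
    proof -
      have "?m ((\<lambda>p\<in>?Q. w (?h p))(Upair a a := t)) = border I a u w t" for w t
      proof
        fix p
        show "?m ((\<lambda>p\<in>?Q. w (?h p))(Upair a a := t)) p = border I a u w t p"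
          unfolding merge_def border_def pairs_insert by auto
      qed
      then show ?thesis by simp
    qed
    finally show "(\<integral>\<^sup>+z. F (?m z) \<partial>PiR (insert (Upair a a) ?Q))
      = (\<integral>\<^sup>+w. \<integral>\<^sup>+t. F (border I a u w t) \<partial>lborel \<partial>PiR I)" .
  qed
  finally show ?thesis .
qed

section \<open>Gram data of vectors and the induction on their number\<close>

definition gram_map :: "'k::finite set \<Rightarrow> ('k \<Rightarrow> real ^ 'm::finite) \<Rightarrow> 'k uprod \<Rightarrow> real" where
  "gram_map I v = (\<lambda>p\<in>pairs I. gram_entry (vec_lambda v) p)"

lemma gram_map_Upair: "i \<in> I \<Longrightarrow> j \<in> I \<Longrightarrow> gram_map I v (Upair i j) = v i \<bullet> v j"
  by (simp add: gram_map_def)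

lemma measurable_gram_map: "gram_map I \<in> PiM I (\<lambda>_. lborel :: (real ^ 'm::finite) measure) \<rightarrow>\<^sub>M PiR (pairs I)"
  unfolding gram_map_def
proof (rule measurable_restrict)
  fix p assume p: "p \<in> pairs I"
  obtain i j where ij: "p = Upair i j" by (cases p)
  have "(\<lambda>v. v i) \<in> borel_measurable (PiM I (\<lambda>_. lborel :: (real ^ 'm) measure))"
      "(\<lambda>v. v j) \<in> borel_measurable (PiM I (\<lambda>_. lborel :: (real ^ 'm) measure))"
    using p measurable_component_singleton[of _ I "\<lambda>_. lborel :: (real ^ 'm) measure"]
    by (auto simp: ij measurable_lborel1)
  then show "(\<lambda>v. gram_entry (vec_lambda v) p) \<in> PiM I (\<lambda>_. lborel :: (real ^ 'm) measure) \<rightarrow>\<^sub>M lborel"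
    unfolding ij gram_entry_Upair vec_lambda_beta measurable_lborel1 by (rule borel_measurable_inner)
qed

lemma udet_gram_map: "udet I (gram_map I v) = gram_det I v"
  by (intro sub_det_cong) (simp add: gram_map_Upair)

text \<open>Presents the new Gram data in the variables w and t of
  \<open>nn_integral_inner_products\<close>.\<close>

lemma gram_map_insert:
  assumes "a \<notin> I"
  shows "gram_map (insert a I) (v(a := x)) = border I a (gram_map I v) (\<lambda>i\<in>I. x \<bullet> v i) (x \<bullet> x)"
proof
  fix p
  consider "p \<notin> pairs (insert a I)" | i j where "i \<in> I" "j \<in> I" "p = Upair i j"
    | "p = Upair a a" | i where "i \<in> I" "p = Upair a i"
  proof (cases p)
    case (Upair i j)
    then show ?thesis
      using that by (cases "i = a"; cases "j = a") (auto; metis Upair_inject)+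
  qed
  then show "gram_map (insert a I) (v(a := x)) p = border I a (gram_map I v) (\<lambda>i\<in>I. x \<bullet> v i) (x \<bullet> x) p"
  proof cases
    case 1
    then show ?thesis by (simp add: gram_map_def border_def)
  next
    case 2
    then show ?thesis using assms by (auto simp: gram_map_Upair border_simps)
  next
    case 3
    then show ?thesis using assms by (simp add: gram_map_Upair border_simps)
  next
    case 4
    then show ?thesis using assms by (auto simp: gram_map_Upair border_simps)
  qed
qed

text \<open>Affine dependence on the corner t. The constant term divided by minus the old
  determinant will be the squared length of the projection.\<close>

lemma udet_border:
  assumes "finite I" "a \<notin> I"
  shows "udet I (border I a u w t) = udet I u"
    "udet (insert a I) (border I a u w t) = t * udet I u + udet (insert a I) (border I a u w 0)"
proof -
  show *: "udet I (border I a u w t) = udet I u" for t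
    using assms by (intro sub_det_cong) (simp add: border_simps)
  let ?N = "\<lambda>t i j. if i = a \<and> j = a then 0 else border I a u w t (Upair i j)"
  have "sub_det (insert a I) (?N t) = sub_det (insert a I) (?N 0)"
    using assms(2) by (intro sub_det_cong) (auto simp: border_simps)
  then show "udet (insert a I) (border I a u w t) = t * udet I u + udet (insert a I) (border I a u w 0)"
    using sub_det_insert_split[OF assms, of "\<lambda>i j. border I a u w t (Upair i j)"]
      sub_det_insert_split[OF assms, of "\<lambda>i j. border I a u w 0 (Upair i j)"] assms(2)
    by (simp add: border_simps *)
qed

lemma gram_weight_border:
  assumes "a \<notin> I"
  shows "gram_weight TYPE('m::finite) I (border I a u w t) = gram_weight TYPE('m) I u"
proof -
  have "udet I (border I a u w t) = udet I u"
    using assms by (intro sub_det_cong) (simp add: border_simps)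
  then show ?thesis
    using assms by (simp add: gram_weight_def gram_region_def border_simps)
qed

text \<open>By \<open>gram_det_insert\<close> the Schur complement of the Gram matrix of v and x is
  the squared height of x over the span of v, so q can be read off from the affine dependence on
  t.\<close>

lemma nn_integral_gram_map_insert:
  fixes v :: "'k::finite \<Rightarrow> real ^ 'm"
  assumes a: "a \<notin> I" and card: "card I < CARD('m)" and D: "gram_det I v > 0"
    and v: "v \<in> space (PiM I (\<lambda>_. lborel))"
    and f: "f \<in> borel_measurable (PiR (pairs (insert a I)))"
  defines "u \<equiv> gram_map I v"
  shows "(\<integral>\<^sup>+x. f (gram_map (insert a I) (v(a := x))) \<partial>lborel) = ennreal (1 / sqrt (udet I u)) *
    (\<integral>\<^sup>+w. \<integral>\<^sup>+t. f (border I a u w t) *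
      ennreal (radial_density (CARD('m) - card I) (udet (insert a I) (border I a u w t) / udet I u)) \<partial>lborel \<partial>PiR I)"
proof -
  have fin: "finite I" by simp
  have u: "u \<in> space (PiR (pairs I))"
    unfolding u_def using measurable_space[OF measurable_gram_map v] .
  have uD: "udet I u = gram_det I v"
    by (simp add: u_def udet_gram_map)
  \<comment> \<open>Chosen so that \<open>t - q w\<close> is the Schur complement, a quotient of two
    determinants.\<close>
  define q where "q w = - udet (insert a I) (border I a u w 0) / udet I u" for w
  have q: "t - q w = udet (insert a I) (border I a u w t) / udet I u" for w t
    using udet_border(2)[OF fin a, of u w t] D uD by (simp add: q_def add_divide_distrib)
  have bm: "(\<lambda>(w, t). border I a u w t) \<in> PiR I \<Otimes>\<^sub>M borel \<rightarrow>\<^sub>M PiR (pairs (insert a I))"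
    unfolding case_prod_unfold using u by (intro measurable_border[OF a]) auto
  have "(\<integral>\<^sup>+x. f (border I a u (\<lambda>i\<in>I. x \<bullet> v i) (x \<bullet> x)) \<partial>lborel) = ennreal (1 / sqrt (gram_det I v)) *
    (\<integral>\<^sup>+w. \<integral>\<^sup>+t. f (border I a u w t) * ennreal (radial_density (CARD('m) - card I) (t - q w)) \<partial>lborel \<partial>PiR I)"
  proof (rule nn_integral_inner_products[OF fin card, where g="\<lambda>w t. f (border I a u w t)"])
    show "gram_det I v \<noteq> 0" using D by simp
    show "(\<lambda>(w, t). f (border I a u w t)) \<in> borel_measurable (PiR I \<Otimes>\<^sub>M borel)"
      using measurable_compose[OF bm f] by (simp add: case_prod_unfold)
    have "(\<lambda>w. border I a u w 0) \<in> PiR I \<rightarrow>\<^sub>M PiR (pairs (insert a I))"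
      using u by (intro measurable_border[OF a]) auto
    from measurable_compose[OF this measurable_udet] show "q \<in> borel_measurable (PiR I)"
      unfolding q_def[abs_def] by (intro borel_measurable_divide borel_measurable_uminus) auto
    fix x y assume xy: "x - y \<in> span (v ` I)" "\<And>i. i \<in> I \<Longrightarrow> y \<bullet> v i = 0"
    let ?v = "v(a := x)"
    have im: "?v ` I = v ` I"
      using a by auto
    have "gram_det (insert a I) ?v = (y \<bullet> y) * gram_det I ?v"
      using xy a by (intro gram_det_insert fin a) (unfold im, auto)
    also have "gram_det I ?v = udet I u"
      unfolding uD using a by (intro sub_det_cong) auto
    finally have "udet (insert a I) (border I a u (\<lambda>i\<in>I. x \<bullet> v i) (x \<bullet> x)) = (y \<bullet> y) * udet I u"
      unfolding u_def gram_map_insert[OF a, symmetric] udet_gram_map .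
    then show "x \<bullet> x = q (\<lambda>i\<in>I. x \<bullet> v i) + y \<bullet> y"
      using q[of "x \<bullet> x" "\<lambda>i\<in>I. x \<bullet> v i"] D uD by (simp add: algebra_simps)
  qed
  then show ?thesis
    unfolding q uD u_def[symmetric] gram_map_insert[OF a] by simp
qed

text \<open>The induction hypothesis, valid for every integrand, is used twice: to discard dependent
  tuples, and to integrate \<open>\<Psi>\<close>, which depends on the old vectors through their
  Gram data only.\<close>

lemma nn_integral_gram_map:
  fixes I :: "'k::finite set"
  assumes "card I \<le> CARD('m::finite)" and "f \<in> borel_measurable (PiR (pairs I))"
  shows "(\<integral>\<^sup>+v. f (gram_map I (v :: 'k \<Rightarrow> real ^ 'm)) \<partial>PiM I (\<lambda>_. lborel))
    = ennreal (\<Prod>j = 1..card I. vol_sphere (CARD('m) - j) / 2) *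
      (\<integral>\<^sup>+u. f u * ennreal (gram_weight TYPE('m) I u) \<partial>PiR (pairs I))"
proof -
  have "finite I" by simp
  then show ?thesis
    using assms
  proof (induction I arbitrary: f rule: finite_induct)
    case empty
    interpret R: product_sigma_finite "\<lambda>_ :: 'k uprod. lborel :: real measure"
      by standard
    interpret V: product_sigma_finite "\<lambda>_ :: 'k. lborel :: (real ^ 'm) measure"
      by standard
    have "gram_weight TYPE('m) ({} :: 'k set) u = 1" for u
      by (simp add: gram_weight_def gram_region_def)
    then show ?case
      by (simp add: R.nn_integral_empty V.nn_integral_empty gram_map_def space_PiM)
  next
    case (insert a I)
    interpret V: product_sigma_finite "\<lambda>_ :: 'k. lborel :: (real ^ 'm) measure"
      by standard
    have a: "a \<notin> I" and fin: "finite I" and card: "card I < CARD('m)" and card': "card I \<le> CARD('m)"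
      using insert by auto
    note f = insert.prems(2)
    define d where "d = CARD('m) - card I"
    let ?P = "PiR (pairs I)" and ?V = "PiM I (\<lambda>_. lborel :: (real ^ 'm) measure)"
    let ?c = "\<lambda>n. ennreal (\<Prod>j = 1..n. vol_sphere (CARD('m) - j) / 2)"
    have IH: "(\<integral>\<^sup>+v. g (gram_map I v) \<partial>?V) = ?c (card I) * (\<integral>\<^sup>+u. g u * ennreal (gram_weight TYPE('m) I u) \<partial>?P)"
      if "g \<in> borel_measurable ?P" for g
      using insert.IH[OF card' that] .
    note [measurable] = measurable_udet[OF fin] measurable_gram_map measurable_gram_weight[OF fin card']
    have bm: "(\<lambda>x. border I a (fst (fst x)) (snd (fst x)) (snd x)) \<in> (?P \<Otimes>\<^sub>M PiR I) \<Otimes>\<^sub>M lborel \<rightarrow>\<^sub>M PiR (pairs (insert a I))"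
      by (intro measurable_border[OF a]) auto
    define h where "h u w t = f (border I a u w t) *
      ennreal (radial_density d (udet (insert a I) (border I a u w t) / udet I u))" for u w t
    have h [measurable]: "(\<lambda>x. h (fst (fst x)) (snd (fst x)) (snd x)) \<in> borel_measurable ((?P \<Otimes>\<^sub>M PiR I) \<Otimes>\<^sub>M lborel)"
    proof -
      have [measurable]: "(\<lambda>x. udet (insert a I) (border I a (fst (fst x)) (snd (fst x)) (snd x)))
          \<in> borel_measurable ((?P \<Otimes>\<^sub>M PiR I) \<Otimes>\<^sub>M lborel)"
        by (rule measurable_compose[OF bm measurable_udet]) simp
      show ?thesis
        unfolding h_def using measurable_compose[OF bm f] by measurable
    qed
    \<comment> \<open>The integral over the new vector, as a function of the old Gram data.\<close>
    define \<Psi> where "\<Psi> u = ennreal (1 / sqrt (udet I u)) * (\<integral>\<^sup>+w. \<integral>\<^sup>+t. h u w t \<partial>lborel \<partial>PiR I)" for u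
    have inner: "(\<lambda>x. \<integral>\<^sup>+t. h (fst x) (snd x) t \<partial>lborel) \<in> borel_measurable (?P \<Otimes>\<^sub>M PiR I)"
      using h by (intro lborel.borel_measurable_nn_integral) (simp add: case_prod_unfold)
    interpret RI: product_sigma_finite "\<lambda>_ :: 'k. lborel :: real measure"
      by standard
    interpret RIf: finite_product_sigma_finite "\<lambda>_ :: 'k. lborel :: real measure" I
      by standard simp
    have "(\<lambda>u. \<integral>\<^sup>+w. \<integral>\<^sup>+t. h u w t \<partial>lborel \<partial>PiR I) \<in> borel_measurable ?P"
      using inner by (intro RIf.borel_measurable_nn_integral) (simp add: case_prod_unfold)
    then have \<Psi> [measurable]: "\<Psi> \<in> borel_measurable ?P"
      unfolding \<Psi>_def[abs_def] by measurable
    have "gram_weight TYPE('m) (insert a I) \<in> borel_measurable (PiR (pairs (insert a I)))"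
      using insert.prems(1) by (intro measurable_gram_weight) auto
    then have fW: "(\<lambda>u. f u * ennreal (c * gram_weight TYPE('m) (insert a I) u))
        \<in> borel_measurable (PiR (pairs (insert a I)))" for c
      by (intro borel_measurable_times_ennreal f measurable_compose[OF _ measurable_ennreal]
          borel_measurable_times borel_measurable_const)
    \<comment> \<open>The indicator of a nonpositive determinant times \<open>gram_weight\<close> is
      identically 0, so by the induction hypothesis the dependent tuples form a null set.\<close>
    have AE: "AE v in ?V. gram_det I v > 0"
    proof -
      let ?g = "\<lambda>u. indicator {x. x \<le> 0} (udet I u) :: ennreal"
      have g: "?g \<in> borel_measurable ?P" by measurable
      have "?g u * ennreal (gram_weight TYPE('m) I u) = 0" for u
        by (auto simp: gram_weight_def gram_region_def indicator_def)
      then have "(\<integral>\<^sup>+v. ?g (gram_map I v) \<partial>?V) = 0"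
        unfolding IH[OF g] by (simp only: nn_integral_const mult_zero_left mult_zero_right)
      then have "AE v in ?V. ?g (gram_map I v) = 0"
        using measurable_compose[OF measurable_gram_map g]
        by (subst (asm) nn_integral_0_iff_AE) auto
      then show ?thesis
        by eventually_elim (auto simp: udet_gram_map indicator_def split: if_splits)
    qed
    have "(\<integral>\<^sup>+v. f (gram_map (insert a I) (v :: 'k \<Rightarrow> real ^ 'm)) \<partial>PiM (insert a I) (\<lambda>_. lborel))
        = (\<integral>\<^sup>+v. \<integral>\<^sup>+x. f (gram_map (insert a I) (v(a := x))) \<partial>lborel \<partial>?V)"
      using measurable_compose[OF measurable_gram_map f]
      by (intro V.product_nn_integral_insert fin a) auto
    also have "\<dots> = (\<integral>\<^sup>+v. \<Psi> (gram_map I v) \<partial>?V)"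
    proof (rule nn_integral_cong_AE)
      show "AE v in ?V. (\<integral>\<^sup>+x. f (gram_map (insert a I) (v(a := x))) \<partial>lborel) = \<Psi> (gram_map I v)"
        using AE AE_space
        by eventually_elim (simp only: nn_integral_gram_map_insert[OF a card _ _ f] \<Psi>_def h_def d_def)
    qed
    also have "\<dots> = ?c (card I) * (\<integral>\<^sup>+u. \<Psi> u * ennreal (gram_weight TYPE('m) I u) \<partial>?P)"
      by (rule IH) (rule \<Psi>)
    also have "(\<integral>\<^sup>+u. \<Psi> u * ennreal (gram_weight TYPE('m) I u) \<partial>?P)
        = (\<integral>\<^sup>+u. \<integral>\<^sup>+w. \<integral>\<^sup>+t. f (border I a u w t) *
            ennreal (vol_sphere (d - 1) / 2 * gram_weight TYPE('m) (insert a I) (border I a u w t)) \<partial>lborel \<partial>PiR I \<partial>?P)"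
    proof (rule nn_integral_cong)
      fix u assume u: "u \<in> space ?P"
      \<comment> \<open>The factors depending on u alone, collected so that
        \<open>gram_weight_insert\<close> merges them with the radial density into the enlarged
        weight.\<close>
      define K where "K = gram_weight TYPE('m) I u * (1 / sqrt (udet I u))"
      have K: "ennreal (1 / sqrt (udet I u)) * ennreal (gram_weight TYPE('m) I u) = ennreal K" "K \<ge> 0"
        by (auto simp: K_def gram_weight_def gram_region_def ennreal_mult'[symmetric] mult.commute)
      have hu: "(\<lambda>x. h u (fst x) (snd x)) \<in> borel_measurable (PiR I \<Otimes>\<^sub>M lborel)"
        using measurable_compose[OF _ h, of "\<lambda>x. ((u, fst x), snd x)" "PiR I \<Otimes>\<^sub>M lborel"] u by simp
      have huw: "h u w \<in> borel_measurable lborel" if "w \<in> space (PiR I)" for w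
        using measurable_compose[OF _ hu, of "\<lambda>t. (w, t)" lborel] that by simp
      have eq: "f (border I a u w t) * ennreal (vol_sphere (d - 1) / 2 * gram_weight TYPE('m) (insert a I) (border I a u w t))
          = ennreal K * h u w t" for w t
      proof -
        have "vol_sphere (d - 1) / 2 * gram_weight TYPE('m) (insert a I) (border I a u w t)
            = K * radial_density d (udet (insert a I) (border I a u w t) / udet I u)"
          unfolding d_def gram_weight_insert[OF fin a card, symmetric] gram_weight_border[OF a]
            udet_border(1)[OF fin a] K_def ..
        then show ?thesis
          using K(2) by (simp add: h_def ennreal_mult radial_density_nonneg mult_ac)
      qed
      have "(\<integral>\<^sup>+w. \<integral>\<^sup>+t. ennreal K * h u w t \<partial>lborel \<partial>PiR I) = (\<integral>\<^sup>+w. ennreal K * (\<integral>\<^sup>+t. h u w t \<partial>lborel) \<partial>PiR I)"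
        by (rule nn_integral_cong) (rule nn_integral_cmult, rule huw)
      also have "\<dots> = ennreal K * (\<integral>\<^sup>+w. \<integral>\<^sup>+t. h u w t \<partial>lborel \<partial>PiR I)"
        using hu by (intro nn_integral_cmult lborel.borel_measurable_nn_integral) (simp add: case_prod_unfold)
      finally show "\<Psi> u * ennreal (gram_weight TYPE('m) I u) = (\<integral>\<^sup>+w. \<integral>\<^sup>+t. f (border I a u w t) *
            ennreal (vol_sphere (d - 1) / 2 * gram_weight TYPE('m) (insert a I) (border I a u w t)) \<partial>lborel \<partial>PiR I)"
        unfolding eq by (simp add: \<Psi>_def K(1)[symmetric] mult_ac)
    qed
    also have "\<dots> = (\<integral>\<^sup>+u. f u * ennreal (vol_sphere (d - 1) / 2 * gram_weight TYPE('m) (insert a I) u) \<partial>PiR (pairs (insert a I)))"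
      by (intro nn_integral_border[OF a, symmetric] fW)
    also have "\<dots> = (\<integral>\<^sup>+u. ennreal (vol_sphere (d - 1) / 2) * (f u * ennreal (gram_weight TYPE('m) (insert a I) u)) \<partial>PiR (pairs (insert a I)))"
    proof -
      have "ennreal (vol_sphere (d - 1) / 2 * gram_weight TYPE('m) (insert a I) u)
          = ennreal (vol_sphere (d - 1) / 2) * ennreal (gram_weight TYPE('m) (insert a I) u)" for u
        using vol_sphere_pos[of "d - 1"] by (intro ennreal_mult gram_weight_nonneg) auto
      then show ?thesis
        by (simp only: mult_ac)
    qed
    also have "\<dots> = ennreal (vol_sphere (d - 1) / 2) * (\<integral>\<^sup>+u. f u * ennreal (gram_weight TYPE('m) (insert a I) u) \<partial>PiR (pairs (insert a I)))"
      using fW[of 1] by (intro nn_integral_cmult) simp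
    \<comment> \<open>Here \<open>d - 1\<close> equals \<open>CARD('m) - card (insert a I)\<close>,
      so the new factor is the one with the largest j in the product.\<close>
    also have "?c (card I) * \<dots> = ?c (card (insert a I)) * (\<integral>\<^sup>+u. f u * ennreal (gram_weight TYPE('m) (insert a I) u) \<partial>PiR (pairs (insert a I)))"
      using fin a vol_sphere_pos
      by (simp add: mult.assoc[symmetric] ennreal_mult'[symmetric] d_def prod_nonneg less_imp_le)
    finally show ?case .
  qed
qed

section \<open>Hilbert measures\<close>

text \<open>The numerical form of O_(n+1)/O_n = S^n: the exponent of sqrt pi grows by n + 1, and the
  Gamma product gains the factor at (n + 1)/2.\<close>

lemma vol_orthogonal_Suc: "vol_orthogonal (Suc n) = vol_orthogonal n * vol_sphere n"
proof -
  have "(Suc n + 1 choose 2) = (n + 1 choose 2) + Suc n"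
    by (simp add: numeral_2_eq_2)
  moreover have "sqrt pi ^ Suc n = pi powr ((real n + 1) / 2)"
    by (simp add: powr_half_sqrt[symmetric] powr_powr powr_realpow[symmetric] add.commute del: power_Suc)
  ultimately have "sqrt pi ^ (Suc n + 1 choose 2) = sqrt pi ^ (n + 1 choose 2) * pi powr ((real n + 1) / 2)"
    by (simp only: power_add)
  moreover have "(\<Prod>j = 1..Suc n. Gamma (real j / 2)) = (\<Prod>j = 1..n. Gamma (real j / 2)) * Gamma ((real n + 1) / 2)"
    by (simp add: add.commute)
  ultimately show ?thesis
    unfolding vol_orthogonal_def vol_sphere_def by (simp only: power_Suc) simp
qed

lemma vol_orthogonal_pos: "vol_orthogonal n > 0"
  by (induction n) (auto simp: vol_orthogonal_Suc vol_sphere_pos, simp add: vol_orthogonal_def)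

text \<open>The quotient telescopes through the spheres S^(m-1), ..., S^(m-k).\<close>

lemma vol_stiefel_eq_prod:
  assumes "k \<le> m"
  shows "vol_stiefel m k = (\<Prod>j = 1..k. vol_sphere (m - j))"
  using assms
proof (induction k)
  case 0
  then show ?case
    using vol_orthogonal_pos[of m] by (simp add: vol_stiefel_def)
next
  case (Suc k)
  then have "m - k = Suc (m - Suc k)" by simp
  then have "vol_orthogonal (m - k) = vol_orthogonal (m - Suc k) * vol_sphere (m - Suc k)"
    by (metis vol_orthogonal_Suc)
  then have "vol_stiefel m (Suc k) = vol_stiefel m k * vol_sphere (m - Suc k)"
    using vol_sphere_pos[of "m - Suc k"] by (simp add: vol_stiefel_def)
  with Suc show ?case by simp
qed

section \<open>Topology, invariance and smoothness of the Hilbert embedding\<close>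

lemma hilbert_embedding_Upair [simp]: "hilbert_embedding v $ Upair i j = v $ i \<bullet> v $ j"
  by (simp add: hilbert_embedding_def)

lemma continuous_on_hilbert_embedding:
  "continuous_on S (hilbert_embedding :: real ^ 'm::finite ^ 'k::finite \<Rightarrow> _)"
  unfolding hilbert_embedding_def
proof (intro continuous_on_vec_lambda)
  fix p :: "'k uprod"
  obtain i j where "p = Upair i j" by (cases p)
  then show "continuous_on S (\<lambda>v :: real ^ 'm ^ 'k. gram_entry v p)"
    by (auto intro!: continuous_intros)
qed

lemma borel_measurable_hilbert_embedding [measurable]: "hilbert_embedding \<in> borel_measurable borel"
  by (intro borel_measurable_continuous_onI continuous_on_hilbert_embedding)

text \<open>A continuous image of a Borel set need not be Borel, but the domain is a countable union
  of compact balls, whose images are compact.\<close>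

lemma range_hilbert_embedding_borel:
  "range (hilbert_embedding :: real ^ 'm::finite ^ 'k::finite \<Rightarrow> _) \<in> sets borel"
proof -
  have UN: "(UNIV :: (real ^ 'm ^ 'k) set) = (\<Union>n::nat. cball 0 (real n))"
    by (auto simp: dist_norm intro: real_arch_simple)
  have "range (hilbert_embedding :: real ^ 'm ^ 'k \<Rightarrow> _)
      = (\<Union>n::nat. hilbert_embedding ` cball (0 :: real ^ 'm ^ 'k) (real n))"
    by (subst UN) (rule image_UN)
  moreover have "hilbert_embedding ` cball (0 :: real ^ 'm ^ 'k) (real n) \<in> sets borel" for n
    by (intro borel_compact compact_continuous_image continuous_on_hilbert_embedding compact_cball)
  ultimately show ?thesis by (auto intro: sets.countable_UN)
qed

text \<open>The diagonal entries are the squared norms of the \<open>v $ i\<close>, so bounded Gram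
  data force bounded vectors. Hence pulled-back bumps have compact support and the push-forward is
  finite on boxes.\<close>

lemma bounded_hilbert_embedding_vimage_box:
  "bounded (hilbert_embedding -` box l r :: (real ^ 'm::finite ^ 'k::finite) set)"
proof -
  have "norm v \<le> (\<Sum>i\<in>UNIV. 1 + r $ Upair i i)" if "v \<in> hilbert_embedding -` box l r" for v :: "real ^ 'm ^ 'k"
  proof -
    have "norm v \<le> (\<Sum>i\<in>UNIV. norm (v $ i))"
      by (simp add: norm_vec_def L2_set_le_sum)
    also have "\<dots> \<le> (\<Sum>i\<in>UNIV. 1 + r $ Upair i i)"
    proof (rule sum_mono)
      fix i :: 'k
      have "v $ i \<bullet> v $ i \<le> r $ Upair i i"
        using that by (auto simp: mem_box_cart dest: spec[of _ "Upair i i"])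
      \<comment> \<open>A bound by the squared norm itself avoids square roots.\<close>
      moreover have "norm (v $ i) \<le> 1 + (norm (v $ i))\<^sup>2"
        using sum_squares_bound[of 1 "norm (v $ i)"] by (simp add: power2_eq_square) (smt (verit) norm_ge_zero)
      ultimately show "norm (v $ i) \<le> 1 + r $ Upair i i"
        by (simp add: dot_square_norm)
    qed
    finally show ?thesis .
  qed
  then show ?thesis by (auto simp: bounded_iff)
qed

lemma hilbert_embedding_diag_action:
  assumes "orthogonal_matrix A"
  shows "hilbert_embedding (diag_action A v) = hilbert_embedding v"
proof -
  have "orthogonal_transformation (\<lambda>x. A *v x)"
    using assms by (simp add: orthogonal_transformation_matrix)
  then have "hilbert_embedding (diag_action A v) $ p = hilbert_embedding v $ p" for p
    by (cases p) (simp add: diag_action_def orthogonal_transformation_def)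
  then show ?thesis by (simp add: vec_eq_iff)
qed

lemma times_cont_diff_hilbert_embedding:
  "times_cont_diff n (\<lambda>v :: real ^ 'm::finite ^ 'k::finite. hilbert_embedding v $ p)"
proof -
  obtain i j where p: "p = Upair i j" by (cases p)
  have "times_cont_diff n (\<lambda>v :: real ^ 'm ^ 'k. v $ i $ l)" for i l
    using times_cont_diff_inner_left[of n "axis i (axis l 1) :: real ^ 'm ^ 'k"] by (simp add: inner_axis)
  then show ?thesis
    unfolding p hilbert_embedding_Upair inner_vec_def inner_real_def
    by (intro times_cont_diff_sum times_cont_diff_mult) auto
qed

section \<open>Smooth approximation of open boxes from inside\<close>

definition box_bump :: "nat \<Rightarrow> real ^ 'n \<Rightarrow> real ^ 'n \<Rightarrow> real ^ 'n::finite \<Rightarrow> real" where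
  "box_bump n l r u =
    (\<Prod>p\<in>UNIV. exp_recip (real n * (u $ p - l $ p)) * exp_recip (real n * (r $ p - u $ p)))"

lemma times_cont_diff_box_bump:
  assumes "\<And>p. times_cont_diff k (\<lambda>x. g x $ p)"
  shows "times_cont_diff k (\<lambda>x. box_bump n l r (g x))"
proof -
  have "times_cont_diff k (\<lambda>x. real n * (g x $ p + - l $ p))"
    "times_cont_diff k (\<lambda>x. real n * (r $ p + (-1) * g x $ p))" for p
    by (intro times_cont_diff_mult times_cont_diff_add times_cont_diff_const assms)+
  then have *: "times_cont_diff k (\<lambda>x. real n * (g x $ p - l $ p))"
    "times_cont_diff k (\<lambda>x. real n * (r $ p - g x $ p))" for p
    by simp_all
  have "times_cont_diff k
      (\<lambda>x. exp_recip (real n * (g x $ p - l $ p)) * exp_recip (real n * (r $ p - g x $ p)))" for p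
    by (rule times_cont_diff_mult[OF times_cont_diff_compose[OF times_cont_diff_exp_recip *(1)]
          times_cont_diff_compose[OF times_cont_diff_exp_recip *(2)]])
  then show ?thesis
    unfolding box_bump_def by (intro times_cont_diff_prod) auto
qed

lemma box_bump_nonneg: "0 \<le> box_bump n l r u"
  by (auto simp: box_bump_def exp_recip_nonneg intro!: prod_nonneg)

lemma box_bump_nonzero: "box_bump n l r u \<noteq> 0 \<Longrightarrow> u \<in> box l r"
proof -
  assume "box_bump n l r u \<noteq> 0"
  then have "exp_recip (real n * (u $ p - l $ p)) \<noteq> 0" "exp_recip (real n * (r $ p - u $ p)) \<noteq> 0" for p
    by (auto simp: box_bump_def)
  then have "0 < real n * (u $ p - l $ p)" "0 < real n * (r $ p - u $ p)" for p
    by (simp_all only: exp_recip_eq_0_iff not_le)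
  then have "l $ p < u $ p" "u $ p < r $ p" for p
    by (metis diff_gt_0_iff_gt of_nat_0_le_iff zero_less_mult_pos order_less_le mult_zero_left)+
  then show "u \<in> box l r"
    by (simp add: mem_box_cart)
qed

lemma exp_recip_scaled_mono: "m \<le> n \<Longrightarrow> exp_recip (real m * x) \<le> exp_recip (real n * x)"
proof (cases "x \<ge> 0")
  case True
  then show "m \<le> n \<Longrightarrow> ?thesis" by (intro exp_recip_mono mult_right_mono) auto
next
  case False
  then have "exp_recip (real m * x) = 0"
    by (simp add: exp_recip_eq_0_iff mult_nonneg_nonpos)
  then show ?thesis by (simp add: exp_recip_nonneg)
qed

lemma box_bump_mono: "m \<le> n \<Longrightarrow> box_bump m l r u \<le> box_bump n l r u"
  unfolding box_bump_def
  by (intro prod_mono conjI mult_mono mult_nonneg_nonneg exp_recip_scaled_mono exp_recip_nonneg)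

text \<open>Every factor tends to 1 strictly inside the box, and some factor is 0 elsewhere, the
  faces included. With \<open>box_bump_mono\<close> this permits monotone convergence.\<close>

lemma box_bump_tendsto: "(\<lambda>n. box_bump n l r u) \<longlonglongrightarrow> indicator (box l r) u"
proof -
  have "(\<lambda>n. box_bump n l r u) \<longlonglongrightarrow> (\<Prod>p\<in>UNIV. indicator {0<..} (u $ p - l $ p) * indicator {0<..} (r $ p - u $ p))"
    unfolding box_bump_def by (intro tendsto_prod tendsto_mult exp_recip_scaled_tendsto)
  also have "(\<Prod>p\<in>UNIV. indicator {0<..} (u $ p - l $ p) * indicator {0<..} (r $ p - u $ p)) = (indicator (box l r) u :: real)"
  proof (cases "u \<in> box l r")
    case True
    then show ?thesis by (simp add: mem_box_cart)
  next
    case False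
    then obtain p where "\<not> (l $ p < u $ p \<and> u $ p < r $ p)"
      by (auto simp: mem_box_cart)
    then have "indicator {0<..} (u $ p - l $ p) * indicator {0<..} (r $ p - u $ p) = (0 :: real)"
      by (auto simp: indicator_def)
    then have "(\<Prod>p\<in>UNIV. indicator {0<..} (u $ p - l $ p) * indicator {0<..} (r $ p - u $ p)) = (0 :: real)"
      by (intro prod_zero bexI[of _ p]) auto
    with False show ?thesis by simp
  qed
  finally show ?thesis .
qed

lemma smooth_compact_support_box_bump: "smooth_compact_support (box_bump n l r)"
proof -
  have "times_cont_diff k (\<lambda>x. x $ p)" for k and p :: 'a
    using times_cont_diff_inner_left[of k "axis p (1 :: real)"] by (simp add: inner_axis inner_real_def)
  then have "times_cont_diff k (box_bump n l r)" for k
    using times_cont_diff_box_bump[of k "\<lambda>x. x" n l r] by simp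
  moreover have "bounded {u. box_bump n l r u \<noteq> 0}"
    by (rule bounded_subset[OF bounded_box[of l r]]) (auto dest: box_bump_nonzero)
  ultimately show ?thesis
    by (simp add: smooth_compact_support_def compact_closure)
qed

lemma smooth_compact_support_box_bump_hilbert_embedding:
  "smooth_compact_support (\<lambda>v :: real ^ 'm::finite ^ 'k::finite. box_bump n l r (hilbert_embedding v))"
proof -
  have "bounded {v :: real ^ 'm ^ 'k. box_bump n l r (hilbert_embedding v) \<noteq> 0}"
    by (rule bounded_subset[OF bounded_hilbert_embedding_vimage_box[of l r]]) (auto dest: box_bump_nonzero)
  then show ?thesis
    unfolding smooth_compact_support_def compact_closure
    using times_cont_diff_box_bump[OF times_cont_diff_hilbert_embedding] by blast
qed

lemma smooth_compact_support_imp_continuous: "smooth_compact_support f \<Longrightarrow> continuous_on S f"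
  using continuous_on_subset[of UNIV f S] times_cont_diff.simps(1)[of f]
  unfolding smooth_compact_support_def by blast

lemma smooth_compact_support_imp_integrable:
  assumes "smooth_compact_support f"
  shows "integrable lborel f"
proof -
  let ?K = "closure {x. f x \<noteq> 0}"
  have "integrable lborel (\<lambda>x. indicator ?K x *\<^sub>R f x)"
    using assms by (intro borel_integrable_compact smooth_compact_support_imp_continuous)
      (auto simp: smooth_compact_support_def)
  also have "(\<lambda>x. indicator ?K x *\<^sub>R f x) = f"
  proof
    fix x
    have "x \<in> ?K" if "f x \<noteq> 0"
      by (rule subsetD[OF closure_subset]) (use that in simp)
    then show "indicator ?K x *\<^sub>R f x = f x"
      by (cases "f x = 0") simp_all
  qed
  finally show ?thesis .
qed

section \<open>Existence and uniqueness of the Hilbert measure\<close>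

definition hilbert_pushforward :: "'m::finite itself \<Rightarrow> (real ^ ('k::finite uprod)) measure" where
  "hilbert_pushforward TYPE('m) =
    distr lborel (restrict_space borel (range (hilbert_embedding :: real ^ 'm ^ 'k \<Rightarrow> _)))
      (hilbert_embedding :: real ^ 'm ^ 'k \<Rightarrow> _)"

lemma measurable_hilbert_embedding_restrict:
  "(hilbert_embedding :: real ^ 'm ^ 'k \<Rightarrow> _) \<in> lborel \<rightarrow>\<^sub>M restrict_space borel (range (hilbert_embedding :: real ^ 'm::finite ^ 'k::finite \<Rightarrow> _))"
  by (intro measurable_restrict_space2) auto

lemma is_hilbert_measure_pushforward:
  "is_hilbert_measure TYPE('m::finite) (hilbert_pushforward TYPE('m) :: (real ^ ('k::finite uprod)) measure)"
  unfolding is_hilbert_measure_def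
proof (intro conjI allI impI)
  fix f :: "real ^ 'm ^ 'k \<Rightarrow> real" and F
  assume "smooth_compact_support f \<and> orthogonal_invariant f \<and>
    smooth_compact_support F \<and> (\<forall>v. f v = F (hilbert_embedding v))"
  then have f: "integrable lborel f" and F: "continuous_on UNIV F" and fF: "f = (\<lambda>v. F (hilbert_embedding v))"
    by (auto intro: smooth_compact_support_imp_integrable smooth_compact_support_imp_continuous)
  have Fm: "F \<in> borel_measurable (restrict_space borel (range (hilbert_embedding :: real ^ 'm ^ 'k \<Rightarrow> _)))"
    using F by (intro measurable_restrict_space1 borel_measurable_continuous_onI)
  show "integrable (hilbert_pushforward TYPE('m)) F"
    unfolding hilbert_pushforward_def
    using f[unfolded fF] by (subst integrable_distr_eq[OF measurable_hilbert_embedding_restrict Fm])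
  show "(\<integral>v. f v \<partial>lborel) = (\<integral>u. F u \<partial>hilbert_pushforward TYPE('m))"
    unfolding hilbert_pushforward_def fF
    by (rule integral_distr[OF measurable_hilbert_embedding_restrict Fm, symmetric])
qed (simp add: hilbert_pushforward_def)

text \<open>The integrals of the pulled-back bumps do not mention the measure, yet they converge to
  its values on open boxes intersected with the image; these values determine it.\<close>

lemma is_hilbert_measure_unique:
  fixes M N :: "(real ^ ('k::finite uprod)) measure"
  assumes M: "is_hilbert_measure TYPE('m::finite) M" and N: "is_hilbert_measure TYPE('m) N"
  shows "M = N"
proof -
  let ?U = "range (hilbert_embedding :: real ^ 'm ^ 'k \<Rightarrow> _)"
  have U: "?U \<in> sets borel"
    by (rule range_hilbert_embedding_borel)
  have lim: "(\<lambda>n. ennreal (\<integral>v. box_bump n l r (hilbert_embedding (v :: real ^ 'm ^ 'k)) \<partial>lborel))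
      \<longlonglongrightarrow> emeasure K (?U \<inter> box l r)"
    and sets: "sets K = sets (restrict_space borel ?U)"
    if K: "is_hilbert_measure TYPE('m) K" for K :: "(real ^ ('k uprod)) measure" and l r
  proof -
    show sets: "sets K = sets (restrict_space borel ?U)"
      using K unfolding is_hilbert_measure_def by blast
    then have space: "space K = ?U"
      using sets_eq_imp_space_eq[OF sets] by (simp add: space_restrict_space)
    have int: "integrable K (box_bump n l r)"
        "(\<integral>v. box_bump n l r (hilbert_embedding (v :: real ^ 'm ^ 'k)) \<partial>lborel) = (\<integral>u. box_bump n l r u \<partial>K)" for n
    proof -
      have "smooth_compact_support (\<lambda>v :: real ^ 'm ^ 'k. box_bump n l r (hilbert_embedding v))"
        "orthogonal_invariant (\<lambda>v :: real ^ 'm ^ 'k. box_bump n l r (hilbert_embedding v))"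
        "smooth_compact_support (box_bump n l r)"
        by (auto simp: orthogonal_invariant_def hilbert_embedding_diag_action
            smooth_compact_support_box_bump smooth_compact_support_box_bump_hilbert_embedding)
      then show "integrable K (box_bump n l r)"
        "(\<integral>v. box_bump n l r (hilbert_embedding (v :: real ^ 'm ^ 'k)) \<partial>lborel) = (\<integral>u. box_bump n l r u \<partial>K)"
        using K unfolding is_hilbert_measure_def by blast+
    qed
    have box: "?U \<inter> box l r \<in> sets K"
      unfolding sets by (auto simp: sets_restrict_space)
    have "(\<lambda>n. \<integral>\<^sup>+u. ennreal (box_bump n l r u) \<partial>K) \<longlonglongrightarrow> (\<integral>\<^sup>+u. ennreal (indicator (box l r) u) \<partial>K)"
      using int(1) by (intro nn_integral_LIMSEQ tendsto_ennrealI box_bump_tendsto)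
        (auto simp: incseq_def le_fun_def box_bump_mono ennreal_leI)
    also have "(\<integral>\<^sup>+u. ennreal (indicator (box l r) u) \<partial>K) = (\<integral>\<^sup>+u. indicator (?U \<inter> box l r) u \<partial>K)"
      by (intro nn_integral_cong) (auto simp: space indicator_def)
    finally have "(\<lambda>n. \<integral>\<^sup>+u. ennreal (box_bump n l r u) \<partial>K) \<longlonglongrightarrow> (\<integral>\<^sup>+u. indicator (?U \<inter> box l r) u \<partial>K)" .
    then show "(\<lambda>n. ennreal (\<integral>v. box_bump n l r (hilbert_embedding (v :: real ^ 'm ^ 'k)) \<partial>lborel))
      \<longlonglongrightarrow> emeasure K (?U \<inter> box l r)"
      using box by (simp add: int(2) nn_integral_eq_integral[OF int(1)] box_bump_nonneg)
  qed
  have ident: "(\<lambda>u. u) \<in> borel_measurable K" if "sets K = sets (restrict_space borel ?U)" for K :: "(real ^ ('k uprod)) measure"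
    unfolding measurable_cong_sets[OF that refl] by (intro measurable_restrict_space1) auto
  \<comment> \<open>The measures live on the image only. Carrying them along the identity to the
    whole Borel space makes the open boxes an intersection-stable generator.\<close>
  have extend: "emeasure (distr K borel (\<lambda>u. u)) B = emeasure K (?U \<inter> B)"
    if "sets K = sets (restrict_space borel ?U)" "B \<in> sets borel" for K :: "(real ^ ('k uprod)) measure" and B
    using ident[OF that(1)] that sets_eq_imp_space_eq[OF that(1)]
    by (subst emeasure_distr) (auto simp: space_restrict_space Int_commute)
  note sM = sets[OF M] and sN = sets[OF N]
  let ?P = "hilbert_pushforward TYPE('m) :: (real ^ ('k uprod)) measure"
  note P = is_hilbert_measure_pushforward[where 'm='m and 'k='k]
  have box_eq: "emeasure M (?U \<inter> box l r) = emeasure N (?U \<inter> box l r)"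
    "emeasure M (?U \<inter> box l r) = emeasure ?P (?U \<inter> box l r)" for l r
    by (rule LIMSEQ_unique[OF lim[OF M] lim[OF N]], rule LIMSEQ_unique[OF lim[OF M] lim[OF P]])
  \<comment> \<open>A limit of finite integrals may be infinite; finiteness comes from comparison
    with the push-forward, since preimages of boxes are bounded.\<close>
  have fin: "emeasure M (?U \<inter> box l r) \<noteq> \<infinity>" for l r
  proof -
    have "emeasure ?P (?U \<inter> box l r) = emeasure lborel (hilbert_embedding -` box l r :: (real ^ 'm ^ 'k) set)"
      unfolding hilbert_pushforward_def
      by (subst emeasure_distr[OF measurable_hilbert_embedding_restrict])
        (auto simp: sets_restrict_space intro!: arg_cong[where f="emeasure lborel"])
    also have "\<dots> < \<infinity>"
      by (intro emeasure_bounded_finite bounded_hilbert_embedding_vimage_box)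
    finally show ?thesis
      using box_eq(2)[of l r] by auto
  qed
  have "distr M borel (\<lambda>u. u) = distr N borel (\<lambda>u. u)"
  proof (rule measure_eqI_generator_eq)
    let ?E = "range (\<lambda>(a, b). box a b :: (real ^ ('k uprod)) set)"
    show "Int_stable ?E"
      by (auto simp: Int_stable_def box_Int_box)
    show "?E \<subseteq> Pow UNIV" "sets (distr M borel (\<lambda>u. u)) = sigma_sets UNIV ?E" "sets (distr N borel (\<lambda>u. u)) = sigma_sets UNIV ?E"
      by (simp_all add: borel_eq_box)
    let ?A = "\<lambda>n::nat. box (- (real n *\<^sub>R One)) (real n *\<^sub>R One) :: (real ^ ('k uprod)) set"
    show "range ?A \<subseteq> ?E" "(\<Union>i. ?A i) = UNIV"
      unfolding UN_box_eq_UNIV by auto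
    show "emeasure (distr M borel (\<lambda>u. u)) (?A i) \<noteq> \<infinity>" for i
      using fin extend[OF sM] by simp
    show "emeasure (distr M borel (\<lambda>u. u)) X = emeasure (distr N borel (\<lambda>u. u)) X" if "X \<in> ?E" for X
      using that box_eq(1) extend[OF sM] extend[OF sN] by auto
  qed
  then have "emeasure M (?U \<inter> B) = emeasure N (?U \<inter> B)" if "B \<in> sets borel" for B
    using extend[OF sM that] extend[OF sN that] by simp
  then show ?thesis
    using sM sN by (intro measure_eqI) (auto simp: sets_restrict_space)
qed

section \<open>The density of the push-forward\<close>

lemma nn_integral_hilbert_embedding:
  fixes f :: "real ^ ('k::finite uprod) \<Rightarrow> ennreal"
  assumes "CARD('k) \<le> CARD('m::finite)" and [measurable]: "f \<in> borel_measurable borel"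
  shows "(\<integral>\<^sup>+v. f (hilbert_embedding (v :: real ^ 'm ^ 'k)) \<partial>lborel)
    = ennreal (\<Prod>j = 1..CARD('k). vol_sphere (CARD('m) - j) / 2) *
      (\<integral>\<^sup>+u. f u * ennreal (gram_weight TYPE('m) UNIV (($) u)) \<partial>lborel)"
proof -
  have gm: "(\<chi> p. gram_map UNIV v p) = hilbert_embedding (\<chi> i. v i)" for v :: "'k \<Rightarrow> real ^ 'm"
    by (simp add: gram_map_def hilbert_embedding_def)
  have 1: "(\<integral>\<^sup>+v. f (hilbert_embedding (v :: real ^ 'm ^ 'k)) \<partial>lborel)
      = (\<integral>\<^sup>+v. f (\<chi> p. gram_map UNIV v p) \<partial>PiM UNIV (\<lambda>_::'k. lborel :: (real ^ 'm) measure))"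
    unfolding gm by (rule nn_integral_lborel_vec) measurable
  have W: "(\<lambda>u :: real ^ ('k uprod). gram_weight TYPE('m) UNIV (($) u)) \<in> borel_measurable borel"
  proof -
    have "(\<lambda>u :: real ^ ('k uprod). ($) u) \<in> borel \<rightarrow>\<^sub>M PiR (UNIV :: 'k uprod set)"
      by (intro measurable_PiM_single') (auto simp: space_PiM)
    from measurable_compose[OF this] measurable_gram_weight[of "UNIV :: 'k set", where 'm='m] assms(1)
    show ?thesis by simp
  qed
  have "($) (vec_lambda u) = u" for u :: "'k uprod \<Rightarrow> real"
    by (simp add: fun_eq_iff)
  then have 2: "(\<integral>\<^sup>+u. f u * ennreal (gram_weight TYPE('m) UNIV (($) u)) \<partial>lborel)
      = (\<integral>\<^sup>+u. f (\<chi> p. u p) * ennreal (gram_weight TYPE('m) UNIV u) \<partial>PiR UNIV)"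
    using W by (subst nn_integral_lborel_vec) auto
  show ?thesis
    unfolding 1 2 using nn_integral_gram_map[of "UNIV :: 'k set" "\<lambda>u. f (\<chi> p. u p)", where 'm='m] assms(1)
    by simp
qed

text \<open>Gram matrices of dependent vectors lie outside \<open>gram_region\<close>, so the left
  side is 0 there; the right side agrees because \<open>0 powr x = 0\<close> for every x, including
  x = 0. On the image the determinant is never negative.\<close>

lemma gram_weight_UNIV:
  fixes u :: "real ^ ('k::finite uprod)"
  shows "gram_weight TYPE('m::finite) UNIV (($) u)
    = indicator (range (hilbert_embedding :: real ^ 'm ^ 'k \<Rightarrow> _)) u
      * det (gram_matrix u) powr ((real CARD('m) - real CARD('k) - 1) / 2)"
proof -
  have det: "udet UNIV (($) u) = det (gram_matrix u)"
    unfolding sub_det_UNIV[symmetric] by (intro sub_det_cong) (simp add: gram_matrix_def)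
  have U: "u \<in> range (hilbert_embedding :: real ^ 'm ^ 'k \<Rightarrow> _) \<longleftrightarrow>
      (\<exists>v :: 'k \<Rightarrow> real ^ 'm. \<forall>i j. u $ Upair i j = v i \<bullet> v j)"
  proof safe
    fix v :: "'k \<Rightarrow> real ^ 'm" assume v: "\<forall>i j. u $ Upair i j = v i \<bullet> v j"
    have "u $ p = hilbert_embedding (\<chi> i. v i) $ p" for p
      by (cases p) (simp add: v)
    then show "u \<in> range (hilbert_embedding :: real ^ 'm ^ 'k \<Rightarrow> _)"
      by (auto simp: vec_eq_iff)
  next
    fix v :: "real ^ 'm ^ 'k"
    show "\<exists>w :: 'k \<Rightarrow> real ^ 'm. \<forall>i j. hilbert_embedding v $ Upair i j = w i \<bullet> w j"
      by (intro exI[of _ "($) v"]) simp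
  qed
  have nonneg: "det (gram_matrix u) \<ge> 0" if u: "u \<in> range (hilbert_embedding :: real ^ 'm ^ 'k \<Rightarrow> _)"
  proof -
    obtain v :: "'k \<Rightarrow> real ^ 'm" where "\<And>i j. u $ Upair i j = v i \<bullet> v j"
      using u U by blast
    then have "udet UNIV (($) u) = gram_det UNIV v"
      by simp
    then show ?thesis
      using gram_det_nonneg[of UNIV v] det by simp
  qed
  have "($) u \<in> gram_region TYPE('m) UNIV \<longleftrightarrow>
      det (gram_matrix u) > 0 \<and> u \<in> range (hilbert_embedding :: real ^ 'm ^ 'k \<Rightarrow> _)"
    unfolding gram_region_def U by (simp add: det)
  then show ?thesis
    unfolding gram_weight_def det using nonneg
    by (cases "u \<in> range (hilbert_embedding :: real ^ 'm ^ 'k \<Rightarrow> _)") (simp_all add: less_le)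
qed

lemma hilbert_pushforward_eq_density:
  assumes "CARD('k::finite) \<le> CARD('m::finite)"
  defines "U \<equiv> range (hilbert_embedding :: real ^ 'm ^ 'k \<Rightarrow> _)"
  shows "(hilbert_pushforward TYPE('m) :: (real ^ ('k uprod)) measure) = density (restrict_space lborel U)
    (\<lambda>u. ennreal (det (gram_matrix u) powr ((real CARD('m) - real CARD('k) - 1) / 2) / 2 ^ CARD('k)
      * (\<Prod>j = 1..CARD('k). vol_sphere (CARD('m) - j))))" (is "_ = density _ ?g")
proof (rule measure_eqI)
  let ?P = "hilbert_pushforward TYPE('m) :: (real ^ ('k uprod)) measure"
  have U: "U \<in> sets borel"
    unfolding U_def by (rule range_hilbert_embedding_borel)
  show "sets ?P = sets (density (restrict_space lborel U) ?g)"
    by (simp add: hilbert_pushforward_def U_def sets_restrict_space)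
  fix A assume "A \<in> sets ?P"
  then have A: "A \<in> sets borel" "A \<subseteq> U" and A': "A \<in> sets (restrict_space borel U)"
    using U by (auto simp: hilbert_pushforward_def sets_restrict_space_iff U_def)
  have "continuous_on UNIV (\<lambda>u :: real ^ ('k uprod). det (gram_matrix u))"
    unfolding det_def gram_matrix_def by (auto intro!: continuous_intros)
  then have [measurable]: "(\<lambda>u :: real ^ ('k uprod). det (gram_matrix u)) \<in> borel_measurable borel"
    by (rule borel_measurable_continuous_onI)
  note [measurable] = U A(1)
  \<comment> \<open>One half for each vector, kept inside the product; together they give the factor
    2^k.\<close>
  define c where "c = (\<Prod>j = 1..CARD('k). vol_sphere (CARD('m) - j) / 2)"
  have c: "c \<ge> 0" "c = (\<Prod>j = 1..CARD('k). vol_sphere (CARD('m) - j)) / 2 ^ CARD('k)"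
    using vol_sphere_pos by (auto simp: c_def less_imp_le prod_dividef intro!: prod_nonneg divide_nonneg_nonneg)
  have "emeasure ?P A = (\<integral>\<^sup>+v. indicator A (hilbert_embedding (v :: real ^ 'm ^ 'k)) \<partial>lborel)"
  proof -
    have "emeasure ?P A = emeasure lborel (hilbert_embedding -` A :: (real ^ 'm ^ 'k) set)"
      unfolding hilbert_pushforward_def
      using A' by (subst emeasure_distr[OF measurable_hilbert_embedding_restrict]) (auto simp: U_def)
    also have "\<dots> = (\<integral>\<^sup>+v. indicator (hilbert_embedding -` A) (v :: real ^ 'm ^ 'k) \<partial>lborel)"
      using measurable_sets_borel[OF borel_measurable_hilbert_embedding A(1)]
      by (intro nn_integral_indicator[symmetric]) simp
    finally show ?thesis by (simp add: indicator_vimage)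
  qed
  also have "\<dots> = ennreal c * (\<integral>\<^sup>+u. indicator A u * ennreal (gram_weight TYPE('m) UNIV (($) u)) \<partial>lborel)"
    unfolding c_def using A by (intro nn_integral_hilbert_embedding assms) auto
  also have "\<dots> = (\<integral>\<^sup>+u. ennreal c * (indicator A u * ennreal (gram_weight TYPE('m) UNIV (($) u))) \<partial>lborel)"
    unfolding gram_weight_UNIV U_def[symmetric] by (intro nn_integral_cmult[symmetric]) measurable
  \<comment> \<open>Since A lies in U, the indicator coming from \<open>gram_weight_UNIV\<close> can
    serve as the restriction to the subspace.\<close>
  also have "\<dots> = (\<integral>\<^sup>+u. ?g u * indicator A u * indicator U u \<partial>lborel)"
    using A(2) c unfolding gram_weight_UNIV U_def[symmetric]
    by (intro nn_integral_cong) (auto simp: indicator_def ennreal_mult'[symmetric] mult_ac)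
  also have "\<dots> = (\<integral>\<^sup>+u. ?g u * indicator A u \<partial>restrict_space lborel U)"
    using U by (subst nn_integral_restrict_space) auto
  also have "\<dots> = emeasure (density (restrict_space lborel U) ?g) A"
    using A' U by (intro emeasure_density[symmetric] measurable_restrict_space1) (auto simp: sets_restrict_space)
  finally show "emeasure ?P A = emeasure (density (restrict_space lborel U) ?g) A" .
qed

theorem theorem1p1:
  fixes M :: "(real ^ ('k::finite uprod)) measure"
    and k m :: nat
    and U :: "(real ^ ('k uprod)) set"
  assumes "k = CARD('k)" and "m = CARD('m::finite)"
    and "k \<le> m"
    and "U = range (hilbert_embedding :: real ^ 'm ^ 'k \<Rightarrow> real ^ ('k uprod))"
  shows "(is_hilbert_measure TYPE('m) M \<longleftrightarrow>
           M = density (restrict_space lborel U)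
             (\<lambda>u. ennreal (det (gram_matrix u) powr ((real m - real k - 1) / 2) / 2 ^ k
                            * (\<Prod>j = 1..k. vol_sphere (m - j)))))
       \<and> (is_hilbert_measure TYPE('m) M \<longleftrightarrow>
           M = density (restrict_space lborel U)
             (\<lambda>u. ennreal (1 / 2 ^ k * vol_stiefel m k
                            * det (gram_matrix u) powr ((real m - real k - 1) / 2))))"
proof -
  \<comment> \<open>Existence and uniqueness turn the predicate into an equation with the
    push-forward, so both equivalences reduce to formulas for its density.\<close>
  have 1: "is_hilbert_measure TYPE('m) M \<longleftrightarrow> M = hilbert_pushforward TYPE('m)"
    using is_hilbert_measure_unique is_hilbert_measure_pushforward by blast
  have 2: "hilbert_pushforward TYPE('m) = density (restrict_space lborel U)
      (\<lambda>u. ennreal (det (gram_matrix u) powr ((real m - real k - 1) / 2) / 2 ^ k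
        * (\<Prod>j = 1..k. vol_sphere (m - j))))"
    using hilbert_pushforward_eq_density[where 'k='k and 'm='m] assms by simp
  have 3: "det (gram_matrix u) powr ((real m - real k - 1) / 2) / 2 ^ k * (\<Prod>j = 1..k. vol_sphere (m - j))
      = 1 / 2 ^ k * vol_stiefel m k * det (gram_matrix u) powr ((real m - real k - 1) / 2)"
    for u :: "real ^ ('k uprod)"
    by (simp add: vol_stiefel_eq_prod[OF assms(3)])
  show ?thesis
    by (simp only: 1 2 3)
qed

end
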